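(* Fix $\lambda,\eta,\nu\in(0,1)$. Let $\mathbf{p}$ be a $(\lambda,\eta,\nu)$-suitable send sequence, and let $T$ be a two-stream externally-jammed process with arrival rate $\lambda$ and send sequence $\mathbf{p}$. Let $\mathcal{R}^T=\{t : \mathbf{stuck}^T(t)=\emptyset\}$. Then with probability $1$, $\mathcal{R}^T$ is finite.
   Context: For $\eta\in(0,1)$ let $\kappa(\eta)=\lceil 3/\eta\rceil$, and $p_*(\lambda,\eta,\nu)=\min\{\lambda/200,\ \lambda\eta/(1800\,\kappa(\eta)^2\log(1/\nu))\}$. A send sequence $\mathbf{p}=p_0,p_1,\dots$ (each $p_j\in(0,1]$) is $(\lambda,\eta,\nu)$-suitable if $p_0=1$ and there is $n_0$ such that for all $n\ge n_0$: $|\{j\in\{1,\dots,n\}: p_j\le p_*(\lambda,\eta,\nu)\}|>\eta n$ and $\nu^n<p_n$. An externally-jammed process $Y$ with arrival rate $\mu$ and send sequence $\mathbf{p}$ with $p_0=1$: bins are positive integers; at time $0$, bin $j$ independently contains a Poisson number of balls with mean $\mu/p_j$. At each step $t\ge1$: a Poisson($\mu$) number of newborn balls is created in a bin $0$; each ball in bin $j\ge0$ (current contents before moving) independently sends with probability $p_j$; every ball that sends moves from bin $j$ to bin $j+1$ (no ball ever leaves); others stay. Newborns at time $t$ therefore all send and enter bin $1$. A two-stream externally-jammed process $T=T(Y^A,Y^B)$ with arrival rate $\lambda$ and send sequence $\mathbf{p}$ consists of two independent externally-jammed processes $Y^A,Y^B$, each with arrival rate $\lambda/2$ and send sequence $\mathbf{p}$;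 balls of $Y^C$ are called $C$-balls. Each ball is in state stuck or unstuck. For $C\in\{A,B\}$, $\mathbf{stuck}^T(C,0)=\emptyset$ (all time-0 balls are unstuck). At step $t\ge1$, let $\mathbf{newstuck}(C,t)$ be $\mathbf{stuck}^T(C,t-1)$ together with the newborn $C$-balls at time $t$, and $\mathbf{stucksend}(C,t)$ the set of balls of $\mathbf{newstuck}(C,t)$ that send at step $t$. If for distinct $C,C'\in\{A,B\}$ we have $\mathbf{stucksend}(C,t)=\emptyset$ and $\mathbf{stucksend}(C',t)\ne\emptyset$, then one ball chosen uniformly at random from $\mathbf{stucksend}(C',t)$ becomes unstuck; otherwise no ball becomes unstuck. Unstuck balls stay unstuck forever; all other balls of $\mathbf{newstuck}(C,t)$ form $\mathbf{stuck}^T(C,t)$. Finally $\mathbf{stuck}^T(t)=\mathbf{stuck}^T(A,t)\cup\mathbf{stuck}^T(B,t)$. *)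

theory Defs
  imports "HOL-Probability.Probability"
begin

section \<open>Suitable send sequences\<close>

definition send_sequence :: "(nat \<Rightarrow> real) \<Rightarrow> bool" where
  "send_sequence p \<longleftrightarrow> (\<forall>j. 0 < p j \<and> p j \<le> 1)"

definition kappa :: "real \<Rightarrow> int" where
  "kappa \<eta> = \<lceil>3 / \<eta>\<rceil>"

definition p_star :: "real \<Rightarrow> real \<Rightarrow> real \<Rightarrow> real" where
  "p_star lam \<eta> \<nu> =
     min (lam / 200) (lam * \<eta> / (1800 * (real_of_int (kappa \<eta>))\<^sup>2 * ln (1 / \<nu>)))"

definition suitable :: "real \<Rightarrow> real \<Rightarrow> real \<Rightarrow> (nat \<Rightarrow> real) \<Rightarrow> bool" where
  "suitable lam \<eta> \<nu> p \<longleftrightarrow>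
     send_sequence p \<and> p 0 = 1 \<and>
     (\<exists>n0. \<forall>n\<ge>n0.
        real (card {j \<in> {1..n}. p j \<le> p_star lam \<eta> \<nu>}) > \<eta> * real n \<and> \<nu> ^ n < p n)"

section \<open>Externally-jammed processes\<close>

text \<open>
  The balls of one process: \<open>Initial j k\<close> is the \<open>k\<close>-th ball that is in bin \<open>j\<close> at time 0,
  \<open>Newborn t k\<close> is the \<open>k\<close>-th ball born at step \<open>t\<close>.
\<close>
datatype ej_ball = Initial nat nat | Newborn nat nat

text \<open>
  An externally-jammed process is a deterministic function of the following independent
  random choices: the initial contents of the bins \<open>j \<ge> 1\<close>, the numbers of newborns at the
  steps \<open>t \<ge> 1\<close>, and, for every \<open>(b, j, t)\<close>, a coin with success probability \<open>p j\<close> which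
  decides whether ball \<open>b\<close> sends at step \<open>t\<close> if it is in bin \<open>j\<close> at that point.  Since a
  ball is in only one bin at each step, at most one of the coins \<open>(b, j, t)\<close>, for \<open>j\<close>
  ranging over the bins, is used.
\<close>
type_synonym ej_process =
  "(nat \<Rightarrow> nat) \<times> (nat \<Rightarrow> nat) \<times> (ej_ball \<times> nat \<times> nat \<Rightarrow> bool)"

definition ej_initial :: "ej_process \<Rightarrow> nat \<Rightarrow> nat" where
  "ej_initial Y = fst Y"

definition ej_births :: "ej_process \<Rightarrow> nat \<Rightarrow> nat" where
  "ej_births Y = fst (snd Y)"

definition ej_coin :: "ej_process \<Rightarrow> ej_ball \<times> nat \<times> nat \<Rightarrow> bool" where
  "ej_coin Y = snd (snd Y)"

definition ej_measure :: "real \<Rightarrow> (nat \<Rightarrow> real) \<Rightarrow> ej_process measure" where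
  "ej_measure \<mu> p =
     (\<Pi>\<^sub>M j\<in>{1..}. measure_pmf (poisson_pmf (\<mu> / p j))) \<Otimes>\<^sub>M
     ((\<Pi>\<^sub>M t\<in>{1..}. measure_pmf (poisson_pmf \<mu>)) \<Otimes>\<^sub>M
      (\<Pi>\<^sub>M (b, j, t)\<in>UNIV. measure_pmf (bernoulli_pmf (p j))))"

definition newborns :: "ej_process \<Rightarrow> nat \<Rightarrow> ej_ball set" where
  "newborns Y t = {Newborn t k | k. k < ej_births Y t}"

text \<open>
  In the next two definitions \<open>B\<close> gives the contents of the bins at the end of step
  \<open>t - 1\<close>.
\<close>
definition add_newborns :: "ej_process \<Rightarrow> nat \<Rightarrow> (nat \<Rightarrow> ej_ball set) \<Rightarrow> (nat \<Rightarrow> ej_ball set)" where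
  "add_newborns Y t B = B(0 := B 0 \<union> newborns Y t)"

definition ej_step :: "ej_process \<Rightarrow> nat \<Rightarrow> (nat \<Rightarrow> ej_ball set) \<Rightarrow> (nat \<Rightarrow> ej_ball set)" where
  "ej_step Y t B j =
     {b \<in> add_newborns Y t B j. \<not> ej_coin Y (b, j, t)} \<union>
     {b. \<exists>i. j = Suc i \<and> b \<in> add_newborns Y t B i \<and> ej_coin Y (b, i, t)}"

primrec ej_bins :: "ej_process \<Rightarrow> nat \<Rightarrow> (nat \<Rightarrow> ej_ball set)" where
  "ej_bins Y 0 = (\<lambda>j. if j = 0 then {} else {Initial j k | k. k < ej_initial Y j})"
| "ej_bins Y (Suc t) = ej_step Y (Suc t) (ej_bins Y t)"

text \<open>The balls that send at step \<open>t\<close>; only meaningful for \<open>t \<ge> 1\<close>.\<close>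
definition ej_sends :: "ej_process \<Rightarrow> nat \<Rightarrow> ej_ball set" where
  "ej_sends Y t = {b. \<exists>j. b \<in> add_newborns Y t (ej_bins Y (t - 1)) j \<and> ej_coin Y (b, j, t)}"

section \<open>Two-stream externally-jammed processes\<close>

datatype stream_label = StreamA | StreamB

fun other :: "stream_label \<Rightarrow> stream_label" where
  "other StreamA = StreamB"
| "other StreamB = StreamA"

text \<open>
  The third component supplies, for each step \<open>t\<close> and each finite nonempty set \<open>S\<close>, a uniformly
  random element of \<open>S\<close>.  It is used at most once per step, with \<open>S\<close> the set of stuck balls
  of one stream that send at step \<open>t\<close>.
\<close>
type_synonym two_stream = "ej_process \<times> ej_process \<times> (nat \<times> ej_ball set \<Rightarrow> ej_ball)"

definition two_stream_measure :: "real \<Rightarrow> (nat \<Rightarrow> real) \<Rightarrow> two_stream measure" where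
  "two_stream_measure lam p =
     ej_measure (lam / 2) p \<Otimes>\<^sub>M (ej_measure (lam / 2) p \<Otimes>\<^sub>M
     (\<Pi>\<^sub>M (t, S)\<in>{(t, S). finite S \<and> S \<noteq> {}}. measure_pmf (pmf_of_set S)))"

text \<open>
  \<open>T\<close> is a random variable on an arbitrary probability space; equality of its law with the
  product measure says that all the random choices have the prescribed distributions and
  are mutually independent.
\<close>
definition two_stream_process ::
  "'a measure \<Rightarrow> real \<Rightarrow> (nat \<Rightarrow> real) \<Rightarrow> ('a \<Rightarrow> two_stream) \<Rightarrow> bool" where
  "two_stream_process M lam p T \<longleftrightarrow>
     prob_space M \<and> T \<in> measurable M (two_stream_measure lam p) \<and>
     distr M (two_stream_measure lam p) T = two_stream_measure lam p"

fun stream :: "two_stream \<Rightarrow> stream_label \<Rightarrow> ej_process" where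
  "stream T StreamA = fst T"
| "stream T StreamB = fst (snd T)"

definition choice :: "two_stream \<Rightarrow> nat \<times> ej_ball set \<Rightarrow> ej_ball" where
  "choice T = snd (snd T)"

text \<open>In the following, \<open>S C\<close> is the set of stuck \<open>C\<close>-balls at the end of step \<open>t - 1\<close>.\<close>

definition newstuck ::
  "two_stream \<Rightarrow> nat \<Rightarrow> (stream_label \<Rightarrow> ej_ball set) \<Rightarrow> stream_label \<Rightarrow> ej_ball set" where
  "newstuck T t S C = S C \<union> newborns (stream T C) t"

definition stucksend ::
  "two_stream \<Rightarrow> nat \<Rightarrow> (stream_label \<Rightarrow> ej_ball set) \<Rightarrow> stream_label \<Rightarrow> ej_ball set" where
  "stucksend T t S C = newstuck T t S C \<inter> ej_sends (stream T C) t"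

definition unstick ::
  "two_stream \<Rightarrow> nat \<Rightarrow> (stream_label \<Rightarrow> ej_ball set) \<Rightarrow> stream_label \<Rightarrow> ej_ball set" where
  "unstick T t S C =
     (if stucksend T t S (other C) = {} \<and> stucksend T t S C \<noteq> {}
      then {choice T (t, stucksend T t S C)} else {})"

primrec stuck_in :: "two_stream \<Rightarrow> nat \<Rightarrow> stream_label \<Rightarrow> ej_ball set" where
  "stuck_in T 0 = (\<lambda>C. {})"
| "stuck_in T (Suc t) =
     (\<lambda>C. newstuck T (Suc t) (stuck_in T t) C - unstick T (Suc t) (stuck_in T t) C)"

text \<open>
  Balls of different streams are distinct, but their names \<^typ>\<open>ej_ball\<close> may coincide, so the
  union is a disjoint union.
\<close>
definition stuck :: "two_stream \<Rightarrow> nat \<Rightarrow> (stream_label \<times> ej_ball) set" where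
  "stuck T t = (SIGMA C:UNIV. stuck_in T t C)"

definition recovery_times :: "two_stream \<Rightarrow> nat set" where
  "recovery_times T = {t. stuck T t = {}}"

text \<open>Two-stream externally-jammed processes exist.\<close>

lemma prob_space_two_stream_measure: "prob_space (two_stream_measure lam p)"
  unfolding two_stream_measure_def ej_measure_def
  by (intro prob_space_pair prob_space_PiM) (auto simp: measure_pmf.prob_space_axioms)

lemma two_stream_process_id: "two_stream_process (two_stream_measure lam p) lam p (\<lambda>T. T)"
  by (simp add: two_stream_process_def prob_space_two_stream_measure distr_id2)

end

theory Submission
  imports Defs "HOL-Real_Asymp.Real_Asymp"
begin

text \<open>
  A stuck ball can only become unstuck at a step at which no stuck ball of the other stream sends.
  Hence, once both streams have many stuck balls in slow bins, unsticking is rare, and the stuck balls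
  fill ever more bins.  An attempt starts with a long window of steps at each of which both
  streams have newborns, so that nothing becomes unstuck; the attempt fails if later, at some age
  \<open>n\<close>, the slow bins up to depth \<open>c log n\<close> of one stream carry too little stuck weight (the sum of the
  send probabilities of the stuck balls).  A first failure at age \<open>n\<close> has probability
  \<open>O(n\<^sup>-\<^sup>2)\<close>: by a Chernoff bound these bins contain enough balls, and, conditionally on the
  trajectories in this stream, an exponential supermartingale in the coins of the other stream shows
  that at most half of this weight became unstuck.  Both bounds are of order \<open>\<nu>\<close> to a large
  multiple of the depth because \<open>p_star\<close> is small.  So an attempt with a long window succeeds with
  probability close to 1, whatever happened before, and almost surely some window occurs.
\<close>

section \<open>Resampling coordinates of a product measure\<close>

text \<open>The obstacle is a circularity: how fast one stream unsticks depends on the noise of the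
  other, which depends on how fast that stream unsticks in turn. Stopping at the first age at which
  either stream is too quiet breaks the circle, because the earlier noise of the other stream is
  then part of the event to be estimated. Moreover, trajectories do not depend on which balls are
  stuck. So the trajectories in one stream can be frozen while the coins of the other are revealed
  step by step, although the stuck sets of the two streams are entangled.

  Conditioning is expressed by resampling: exchanging some coordinates for an independent copy
  preserves a product measure, so an integral becomes a double integral in which everything that
  does not read the exchanged coordinates is constant for the inner one.\<close>

definition mix_fun :: "'i set \<Rightarrow> ('i \<Rightarrow> 'v) \<Rightarrow> ('i \<Rightarrow> 'v) \<Rightarrow> 'i \<Rightarrow> 'v" where
  "mix_fun K x y = (\<lambda>i. if i \<in> K then y i else x i)"

text \<open>\<open>f x y\<close> stands for \<open>x\<close> with some coordinates taken from
  \<open>y\<close>. The equation says that for independent \<open>x\<close> and \<open>y\<close> of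
  law \<open>M\<close> the result again has law \<open>M\<close>, in the iterated form in which it
  is applied.\<close>

definition resampling :: "'c measure \<Rightarrow> ('c \<Rightarrow> 'c \<Rightarrow> 'c) \<Rightarrow> bool" where
  "resampling M f \<longleftrightarrow> prob_space M \<and> case_prod f \<in> measurable (M \<Otimes>\<^sub>M M) M \<and>
     (\<forall>F\<in>borel_measurable M. (\<integral>\<^sup>+x. F x \<partial>M) = (\<integral>\<^sup>+x. \<integral>\<^sup>+y. F (f x y) \<partial>M \<partial>M))"

lemma resamplingD:
  assumes "resampling M f"
  shows "prob_space M" "case_prod f \<in> measurable (M \<Otimes>\<^sub>M M) M"
    "F \<in> borel_measurable M \<Longrightarrow> (\<integral>\<^sup>+x. F x \<partial>M) = (\<integral>\<^sup>+x. \<integral>\<^sup>+y. F (f x y) \<partial>M \<partial>M)"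
  using assms unfolding resampling_def by auto

lemma resampling_PiM:
  assumes "\<And>i. prob_space (M i)"
  shows "resampling (PiM I M) (mix_fun K)"
proof -
  interpret product_prob_space M I
    by (rule product_prob_spaceI) (rule assms)
  let ?P = "PiM I M"
  interpret P: prob_space ?P by (rule prob_space_PiM) (rule assms)
  interpret PP: pair_prob_space ?P ?P ..
  have m: "case_prod (mix_fun K) \<in> measurable (?P \<Otimes>\<^sub>M ?P) ?P"
  proof (rule measurable_PiM_single')
    fix i assume "i \<in> I"
    then show "(\<lambda>z. (case z of (x, y) \<Rightarrow> mix_fun K x y) i) \<in> measurable (?P \<Otimes>\<^sub>M ?P) (M i)"
      by (cases "i \<in> K") (simp_all add: mix_fun_def split_beta)
  next
    show "(\<lambda>z i. (case z of (x, y) \<Rightarrow> mix_fun K x y) i) \<in> space (?P \<Otimes>\<^sub>M ?P) \<rightarrow> (\<Pi>\<^sub>E i\<in>I. space (M i))"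
      by (auto simp: mix_fun_def space_pair_measure space_PiM PiE_iff extensional_def)
  qed
  have d: "distr (?P \<Otimes>\<^sub>M ?P) ?P (case_prod (mix_fun K)) = ?P"
  proof (rule PiM_eq)
    fix J F assume J: "finite J" "J \<subseteq> I" and F: "\<And>j. j \<in> J \<Longrightarrow> F j \<in> sets (M j)"
    let ?A = "\<lambda>L. prod_emb I M L (\<Pi>\<^sub>E j\<in>L. F j)"
    have A: "?A L \<in> sets ?P" if "L \<subseteq> J" for L
      using J that F by (intro sets_PiM_I) (auto intro: finite_subset)
    \<comment> \<open>Coordinates outside \<open>K\<close> come from the first copy and those in
      \<open>K\<close> from the second, so the preimage of a box is a product of two boxes and its
      measure factorizes.\<close>
    have eq: "case_prod (mix_fun K) -` ?A J \<inter> space (?P \<Otimes>\<^sub>M ?P) = ?A (J - K) \<times> ?A (J \<inter> K)"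
      using J by (auto simp: prod_emb_def space_pair_measure space_PiM PiE_iff mix_fun_def split: if_splits) 
        (auto simp: extensional_def)
    have "emeasure (distr (?P \<Otimes>\<^sub>M ?P) ?P (case_prod (mix_fun K))) (?A J) =
        emeasure ?P (?A (J - K)) * emeasure ?P (?A (J \<inter> K))"
      by (subst emeasure_distr[OF m A]) (auto simp: eq A intro!: P.emeasure_pair_measure_Times)
    also have "\<dots> = (\<Prod>j\<in>J-K. emeasure (M j) (F j)) * (\<Prod>j\<in>J\<inter>K. emeasure (M j) (F j))"
      using J F by (subst (1 2) emeasure_PiM_emb) auto
    also have "\<dots> = (\<Prod>j\<in>(J-K)\<union>(J\<inter>K). emeasure (M j) (F j))"
      using J by (intro prod.union_disjoint[symmetric]) auto
    finally show "emeasure (distr (?P \<Otimes>\<^sub>M ?P) ?P (case_prod (mix_fun K))) (?A J) = (\<Prod>j\<in>J. emeasure (M j) (F j))"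
      by (simp only: Un_Diff_Int)
  qed simp
  show ?thesis unfolding resampling_def
  proof (intro conjI ballI)
    fix F :: "_ \<Rightarrow> ennreal" assume F: "F \<in> borel_measurable ?P"
    have "(\<integral>\<^sup>+x. F x \<partial>?P) = (\<integral>\<^sup>+z. F (case_prod (mix_fun K) z) \<partial>(?P \<Otimes>\<^sub>M ?P))"
      by (subst d[symmetric], subst nn_integral_distr[OF m]) (auto simp: F)
    also have "\<dots> = (\<integral>\<^sup>+x. \<integral>\<^sup>+y. F (mix_fun K x y) \<partial>?P \<partial>?P)"
      using measurable_compose[OF m F] by (subst P.nn_integral_fst[symmetric]) (auto simp: split_beta)
    finally show "(\<integral>\<^sup>+x. F x \<partial>?P) = (\<integral>\<^sup>+x. \<integral>\<^sup>+y. F (mix_fun K x y) \<partial>?P \<partial>?P)" .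
  qed (use m in \<open>auto intro: P.prob_space_axioms\<close>)
qed

lemma resampling_pair:
  assumes "resampling M f" "resampling N g"
  shows "resampling (M \<Otimes>\<^sub>M N) (\<lambda>(a, b) (a', b'). (f a a', g b b'))"
proof -
  interpret M: prob_space M by (rule resamplingD[OF assms(1)])
  interpret N: prob_space N by (rule resamplingD[OF assms(2)])
  interpret MN: pair_prob_space M N ..
  interpret NM: pair_prob_space N M ..
  note [measurable] = resamplingD(2)[OF assms(1)] resamplingD(2)[OF assms(2)]
  have fm [measurable (raw)]: "(\<lambda>x. f (u x) (v x)) \<in> measurable L M" if "u \<in> measurable L M" "v \<in> measurable L M" for u v L
    using measurable_compose[OF measurable_Pair[OF that] resamplingD(2)[OF assms(1)]] by simp
  have gm [measurable (raw)]: "(\<lambda>x. g (u x) (v x)) \<in> measurable L N" if "u \<in> measurable L N" "v \<in> measurable L N" for u v L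
    using measurable_compose[OF measurable_Pair[OF that] resamplingD(2)[OF assms(2)]] by simp
  show ?thesis unfolding resampling_def
  proof (intro conjI ballI)
    show "prob_space (M \<Otimes>\<^sub>M N)" by (rule MN.prob_space_axioms)
    show "(\<lambda>(x, y). (case x of (a, b) \<Rightarrow> \<lambda>(a', b'). (f a a', g b b')) y)
      \<in> measurable ((M \<Otimes>\<^sub>M N) \<Otimes>\<^sub>M (M \<Otimes>\<^sub>M N)) (M \<Otimes>\<^sub>M N)"
      unfolding split_beta by measurable
    fix F :: "_ \<Rightarrow> ennreal" assume F [measurable]: "F \<in> borel_measurable (M \<Otimes>\<^sub>M N)"
    have "(\<integral>\<^sup>+x. F x \<partial>(M \<Otimes>\<^sub>M N)) = (\<integral>\<^sup>+a. \<integral>\<^sup>+b. F (a, b) \<partial>N \<partial>M)"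
      by (subst N.nn_integral_fst[symmetric]) auto
    \<comment> \<open>The two components are resampled one after the other; swapping integrals
      before and after the second resampling brings the fresh copies of \<open>M\<close> and
      \<open>N\<close> innermost.\<close>
    also have "\<dots> = (\<integral>\<^sup>+a. \<integral>\<^sup>+b. \<integral>\<^sup>+b'. F (a, g b b') \<partial>N \<partial>N \<partial>M)"
      by (intro nn_integral_cong resamplingD(3)[OF assms(2)]) measurable
    also have "\<dots> = (\<integral>\<^sup>+b. \<integral>\<^sup>+a. \<integral>\<^sup>+b'. F (a, g b b') \<partial>N \<partial>M \<partial>N)"
      by (rule NM.Fubini') measurable
    also have "\<dots> = (\<integral>\<^sup>+b. \<integral>\<^sup>+a. \<integral>\<^sup>+a'. \<integral>\<^sup>+b'. F (f a a', g b b') \<partial>N \<partial>M \<partial>M \<partial>N)"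
      by (intro nn_integral_cong resamplingD(3)[OF assms(1)]) measurable
    also have "\<dots> = (\<integral>\<^sup>+a. \<integral>\<^sup>+b. \<integral>\<^sup>+a'. \<integral>\<^sup>+b'. F (f a a', g b b') \<partial>N \<partial>M \<partial>N \<partial>M)"
      by (rule MN.Fubini') measurable
    also have "\<dots> = (\<integral>\<^sup>+a. \<integral>\<^sup>+b. \<integral>\<^sup>+y. F (f a (fst y), g b (snd y)) \<partial>(M \<Otimes>\<^sub>M N) \<partial>N \<partial>M)"
    proof (intro nn_integral_cong)
      fix a b assume [measurable]: "a \<in> space M" "b \<in> space N"
      show "(\<integral>\<^sup>+a'. \<integral>\<^sup>+b'. F (f a a', g b b') \<partial>N \<partial>M) = (\<integral>\<^sup>+y. F (f a (fst y), g b (snd y)) \<partial>(M \<Otimes>\<^sub>M N))"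
        by (subst N.nn_integral_fst[symmetric]) auto
    qed
    also have "\<dots> = (\<integral>\<^sup>+x. \<integral>\<^sup>+y. F (f (fst x) (fst y), g (snd x) (snd y)) \<partial>(M \<Otimes>\<^sub>M N) \<partial>(M \<Otimes>\<^sub>M N))"
      by (subst N.nn_integral_fst[symmetric]) (auto)
    finally show "(\<integral>\<^sup>+x. F x \<partial>(M \<Otimes>\<^sub>M N)) = 
       (\<integral>\<^sup>+x. \<integral>\<^sup>+y. F ((case x of (a, b) \<Rightarrow> \<lambda>(a', b'). (f a a', g b b')) y) \<partial>(M \<Otimes>\<^sub>M N) \<partial>(M \<Otimes>\<^sub>M N))"
      by (simp add: split_beta)
  qed
qed

text \<open>The degenerate case, for the initial contents and the choices: these always keep their
  values.\<close>

lemma resampling_fst: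
  assumes "prob_space M"
  shows "resampling M (\<lambda>x y. x)"
  using assms by (auto simp: resampling_def prob_space.emeasure_space_1)

section \<open>Resampling births and coins of both streams\<close>

definition mix_ej :: "nat set \<Rightarrow> (ej_ball \<times> nat \<times> nat) set \<Rightarrow> ej_process \<Rightarrow> ej_process \<Rightarrow> ej_process" where
  "mix_ej KB KC = (\<lambda>(i, b, c) (i', b', c'). (i, mix_fun KB b b', mix_fun KC c c'))"

definition mix :: "(stream_label \<Rightarrow> nat set) \<Rightarrow> (stream_label \<Rightarrow> (ej_ball \<times> nat \<times> nat) set) \<Rightarrow>
    two_stream \<Rightarrow> two_stream \<Rightarrow> two_stream" where
  "mix KB KC = (\<lambda>(a, b, c) (a', b', c').
     (mix_ej (KB StreamA) (KC StreamA) a a', mix_ej (KB StreamB) (KC StreamB) b b', c))"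

abbreviation births :: "two_stream \<Rightarrow> stream_label \<Rightarrow> nat \<Rightarrow> nat" where
  "births T C \<equiv> ej_births (stream T C)"

abbreviation coin :: "two_stream \<Rightarrow> stream_label \<Rightarrow> ej_ball \<times> nat \<times> nat \<Rightarrow> bool" where
  "coin T C \<equiv> ej_coin (stream T C)"

lemma mix_simps [simp]:
  "births (mix KB KC T T') C s = (if s \<in> KB C then births T' C s else births T C s)"
  "coin (mix KB KC T T') C x = (if x \<in> KC C then coin T' C x else coin T C x)"
  "ej_initial (stream (mix KB KC T T') C) = ej_initial (stream T C)"
  "choice (mix KB KC T T') = choice T"
  by (cases C; auto simp: mix_def mix_ej_def mix_fun_def ej_births_def ej_coin_def ej_initial_def 
    choice_def split_beta)+

lemma resampling_mix: "resampling (two_stream_measure lam p) (mix KB KC)"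
proof -
  have P: "resampling (PiM I (\<lambda>i. measure_pmf (q i))) (mix_fun K)" "prob_space (PiM I (\<lambda>i. measure_pmf (q i)))"
    for I :: "'i set" and q :: "'i \<Rightarrow> 'v pmf" and K
    by (intro resampling_PiM prob_space_PiM measure_pmf.prob_space_axioms)+
  have ej: "resampling (ej_measure \<mu> p) (mix_ej K K')" for \<mu> K K'
  proof -
    have eq: "mix_ej K K' = (\<lambda>(a, b) (a', b'). (a, (\<lambda>(b, c) (b', c'). (mix_fun K b b', mix_fun K' c c')) b b'))"
      by (auto simp: mix_ej_def fun_eq_iff)
    have "(\<lambda>(b :: ej_ball, j, t :: nat). measure_pmf (bernoulli_pmf (p j))) = 
        (\<lambda>i. measure_pmf ((\<lambda>(b, j, t). bernoulli_pmf (p j)) i))"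
      by auto
    then show ?thesis unfolding ej_measure_def eq
      using resampling_pair[OF resampling_fst[OF P(2)] resampling_pair[OF P(1) P(1)]] by simp
  qed
  have eq: "mix KB KC = (\<lambda>(a, b) (a', b'). (mix_ej (KB StreamA) (KC StreamA) a a', 
      (\<lambda>(b, c) (b', c'). (mix_ej (KB StreamB) (KC StreamB) b b', c)) b b'))"
    by (auto simp: mix_def fun_eq_iff)
  have "(\<lambda>(t :: nat, S :: ej_ball set). measure_pmf (pmf_of_set S)) = 
      (\<lambda>i. measure_pmf ((\<lambda>(t, S). pmf_of_set S) i))"
    by auto
  then show ?thesis unfolding two_stream_measure_def eq
    using resampling_pair[OF ej resampling_pair[OF ej resampling_fst[OF P(2)]]] by simp
qed

section \<open>Trajectories of newborn balls\<close>

text \<open>\<open>pos Y b s a\<close> is the bin of a ball \<open>b\<close> born at step \<open>s\<close> at the end of step \<open>s + a - 1\<close>.\<close>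
primrec pos :: "ej_process \<Rightarrow> ej_ball \<Rightarrow> nat \<Rightarrow> nat \<Rightarrow> nat" where
  "pos Y b s 0 = 0"
| "pos Y b s (Suc a) =
     (if ej_coin Y (b, pos Y b s a, s + a) then Suc (pos Y b s a) else pos Y b s a)"

lemma Newborn_in_bins_le: "Newborn s k \<in> ej_bins Y t j \<Longrightarrow> s \<le> t"
proof (induction t arbitrary: j)
  case 0
  then show ?case by (auto split: if_splits)
next
  case (Suc t)
  then show ?case
    by (fastforce simp: ej_step_def add_newborns_def newborns_def split: if_splits)
qed

text \<open>The bins are inspected after the newborns of the step are added, that is, at the moment
  of sending. At age 0 the ball is then already in bin 0, which matches
  \<open>pos Y b s 0 = 0\<close>.\<close>

lemma Newborn_in_add_newborns_iff:
  assumes "1 \<le> s"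
  shows "Newborn s k \<in> add_newborns Y (s + a) (ej_bins Y (s + a - 1)) j \<longleftrightarrow>
    k < ej_births Y s \<and> j = pos Y (Newborn s k) s a"
proof (induction a arbitrary: j)
  case 0
  have "Newborn s k \<notin> ej_bins Y (s - 1) i" for i
    using Newborn_in_bins_le[of s k Y "s - 1" i] assms by auto
  then show ?case
    by (auto simp: add_newborns_def newborns_def)
next
  case (Suc a)
  obtain s' where s': "s = Suc s'" using assms by (cases s) auto
  have "Newborn s k \<in> add_newborns Y (s + Suc a) (ej_bins Y (s + Suc a - 1)) j \<longleftrightarrow>
      Newborn s k \<in> ej_step Y (s + a) (ej_bins Y (s + a - 1)) j"
    by (auto simp: add_newborns_def newborns_def s')
  also have "\<dots> \<longleftrightarrow> k < ej_births Y s \<and> j = pos Y (Newborn s k) s (Suc a)"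
    unfolding ej_step_def using Suc.IH by auto
  finally show ?case .
qed

lemma Newborn_in_sends_iff:
  assumes "1 \<le> s"
  shows "Newborn s k \<in> ej_sends Y t \<longleftrightarrow>
    s \<le> t \<and> k < ej_births Y s \<and> ej_coin Y (Newborn s k, pos Y (Newborn s k) s (t - s), t)"
proof (cases "s \<le> t")
  case True
  then obtain a where t: "t = s + a" using le_Suc_ex by blast
  show ?thesis unfolding ej_sends_def t
    using Newborn_in_add_newborns_iff[OF assms, of k Y a] by auto
next
  case False
  then have "Newborn s k \<notin> add_newborns Y t (ej_bins Y (t - 1)) j" for j
    using Newborn_in_bins_le[of s k Y "t - 1" j] by (auto simp: add_newborns_def newborns_def)
  then show ?thesis using False by (auto simp: ej_sends_def)
qed

text \<open>Each send moves the ball by one bin, so its bin number counts its sends. This later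
  bounds how often a ball can be charged.\<close>

lemma pos_eq_card:
  "pos Y b s a = card {u \<in> {s..<s + a}. ej_coin Y (b, pos Y b s (u - s), u)}"
proof (induction a)
  case (Suc a)
  let ?S = "\<lambda>a. {u \<in> {s..<s + a}. ej_coin Y (b, pos Y b s (u - s), u)}"
  have "?S (Suc a) = (if ej_coin Y (b, pos Y b s a, s + a) then insert (s + a) (?S a) else ?S a)"
    by (auto simp: less_Suc_eq)
  moreover have "s + a \<notin> ?S a" "finite (?S a)" by auto
  ultimately show ?case using Suc by simp
qed simp

section \<open>Unsticking in the two-stream process\<close>

text \<open>Time-0 balls start unstuck and stay so; only newborn balls have to be followed.\<close>

lemma stuck_in_newborn:
  "b \<in> stuck_in T t C \<Longrightarrow> \<exists>s k. b = Newborn s k \<and> 1 \<le> s \<and> s \<le> t \<and> k < births T C s"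
proof (induction t)
  case (Suc t)
  from Suc.prems have "b \<in> stuck_in T t C \<or> b \<in> newborns (stream T C) (Suc t)"
    by (auto simp: newstuck_def)
  then show ?case using Suc.IH by (fastforce simp: newborns_def)
qed simp

lemma finite_stuck_in: "finite (stuck_in T t C)"
  by (induction t) (auto simp: newstuck_def newborns_def)

definition silent :: "two_stream \<Rightarrow> stream_label \<Rightarrow> nat \<Rightarrow> bool" where
  "silent T C u \<longleftrightarrow> stucksend T u (stuck_in T (u - 1)) C = {}"

text \<open>A null set has to be excluded: \<^const>\<open>choice\<close> is only almost surely a choice function.\<close>
definition choice_ok :: "two_stream \<Rightarrow> bool" where
  "choice_ok T \<longleftrightarrow> (\<forall>t S. finite S \<longrightarrow> S \<noteq> {} \<longrightarrow> choice T (t, S) \<in> S)"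

lemma unstuck_imp_unstick:
  assumes "1 \<le> s" "s \<le> t" "k < births T C s" "Newborn s k \<notin> stuck_in T t C"
  shows "\<exists>u. s \<le> u \<and> u \<le> t \<and> Newborn s k \<in> newstuck T u (stuck_in T (u - 1)) C \<and>
     Newborn s k \<in> unstick T u (stuck_in T (u - 1)) C"
  using assms(2,4)
proof (induction t rule: dec_induct)
  case base
  obtain s' where s': "s = Suc s'" using assms(1) by (cases s) auto
  have "Newborn s k \<in> newstuck T s (stuck_in T (s - 1)) C"
    using assms(3) by (auto simp: newstuck_def newborns_def)
  then show ?case using base by (auto simp: s')
next
  case (step t)
  show ?case
  proof (cases "Newborn s k \<in> stuck_in T t C")
    case True
    then have "Newborn s k \<in> newstuck T (Suc t) (stuck_in T t) C" by (simp add: newstuck_def)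
    then show ?thesis using step by (intro exI[of _ "Suc t"]) auto
  next
    case False
    then show ?thesis using step.IH by (meson le_Suc_eq)
  qed
qed

lemma unstickD:
  assumes "choice_ok T" "b \<in> unstick T u (stuck_in T (u - 1)) C"
  shows "silent T (other C) u" "b \<in> ej_sends (stream T C) u"
    "unstick T u (stuck_in T (u - 1)) C = {b}"
proof -
  let ?S = "stucksend T u (stuck_in T (u - 1)) C"
  have *: "stucksend T u (stuck_in T (u - 1)) (other C) = {}" "?S \<noteq> {}" "b = choice T (u, ?S)"
    using assms(2) by (auto simp: unstick_def split: if_splits)
  show "silent T (other C) u" using * by (simp add: silent_def)
  have "finite ?S" by (auto simp: stucksend_def newstuck_def newborns_def finite_stuck_in)
  then have "b \<in> ?S" using assms(1) * by (auto simp: choice_ok_def)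
  then show "b \<in> ej_sends (stream T C) u" by (auto simp: stucksend_def)
  show "unstick T u (stuck_in T (u - 1)) C = {b}" using * by (auto simp: unstick_def)
qed

text \<open>
  Only the first newborn ball of each step is tracked.  \<open>bin T C s t\<close> is the bin at the end of
  step \<open>t\<close> of the one born at step \<open>s\<close>.
\<close>
definition bin :: "two_stream \<Rightarrow> stream_label \<Rightarrow> nat \<Rightarrow> nat \<Rightarrow> nat" where
  "bin T C s t = pos (stream T C) (Newborn s 0) s (Suc t - s)"

text \<open>For \<open>u = s \<ge> 1\<close> the age hidden in \<open>bin T C s (u - 1)\<close> is
  0, so the coin read at birth is the one of bin 0.\<close>

definition first_sends :: "two_stream \<Rightarrow> stream_label \<Rightarrow> nat \<Rightarrow> nat \<Rightarrow> bool" where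
  "first_sends T C s u \<longleftrightarrow> s \<le> u \<and> coin T C (Newborn s 0, bin T C s (u - 1), u)"

lemma first_in_sends_iff:
  assumes "1 \<le> s"
  shows "Newborn s 0 \<in> ej_sends (stream T C) u \<longleftrightarrow> 1 \<le> births T C s \<and> first_sends T C s u"
  using Newborn_in_sends_iff[OF assms, of 0 "stream T C" u] assms
  by (auto simp: first_sends_def bin_def)

lemma bin_eq_card:
  assumes "1 \<le> s"
  shows "bin T C s t = card {u \<in> {s..t}. first_sends T C s u}"
proof -
  have "{u \<in> {s..<s + (Suc t - s)}. ej_coin (stream T C) (Newborn s 0, pos (stream T C) (Newborn s 0) s (u - s), u)} =
     {u \<in> {s..t}. first_sends T C s u}"
    using assms by (auto simp: first_sends_def bin_def)
  then show ?thesis unfolding bin_def by (subst pos_eq_card) simp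
qed

definition firsts :: "two_stream \<Rightarrow> stream_label \<Rightarrow> nat \<Rightarrow> nat \<Rightarrow> nat set" where
  "firsts T C lo t = {s \<in> {lo<..t}. 1 \<le> births T C s}"

lemma firstsD: "s \<in> firsts T C lo t \<Longrightarrow> 1 \<le> s \<and> lo < s \<and> s \<le> t \<and> 1 \<le> births T C s"
  by (auto simp: firsts_def)

lemma finite_firsts [simp]: "finite (firsts T C lo t)"
  by (auto simp: firsts_def)

text \<open>If \<open>W j\<close> is \<open>p j\<close> on a set of bins and 0 elsewhere, this is
  the expected number, given the positions at the end of step \<open>t\<close>, of tracked balls
  that send from these bins at the next step.\<close>

definition weight :: "(nat \<Rightarrow> real) \<Rightarrow> two_stream \<Rightarrow> stream_label \<Rightarrow> nat \<Rightarrow> nat \<Rightarrow> real" where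
  "weight W T C lo t = (\<Sum>s\<in>firsts T C lo t. W (bin T C s t))"

definition stuck_weight :: "(nat \<Rightarrow> real) \<Rightarrow> two_stream \<Rightarrow> stream_label \<Rightarrow> nat \<Rightarrow> nat \<Rightarrow> real" where
  "stuck_weight W T C lo t =
     (\<Sum>s\<in>firsts T C lo t. if Newborn s 0 \<in> stuck_in T t C then W (bin T C s t) else 0)"

text \<open>
  The cap \<open>a\<close> bounds the increments of the supermartingale below; it does no harm, since at most
  one ball becomes unstuck per step.
\<close>
definition send_weight :: "real \<Rightarrow> (nat \<Rightarrow> real) \<Rightarrow> two_stream \<Rightarrow> stream_label \<Rightarrow> nat \<Rightarrow> nat \<Rightarrow> nat \<Rightarrow> real" where
  "send_weight a W T C lo t u =
     min a (\<Sum>s\<in>firsts T C lo t. if first_sends T C s u then W (bin T C s t) else 0)"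

lemma send_weight_bounds:
  assumes "\<And>j. 0 \<le> W j" "0 \<le> a"
  shows "0 \<le> send_weight a W T C lo t u" "send_weight a W T C lo t u \<le> a"
  using assms by (auto simp: send_weight_def intro!: sum_nonneg)

text \<open>A ball of nonzero weight sits in a bin \<open>j \<le> m\<close>, so it has sent only
  \<open>j\<close> times since its birth and contributes to at most \<open>m\<close> of the
  terms.\<close>

lemma sum_send_weight_le:
  assumes "\<And>j. 0 \<le> W j" "\<And>j. m < j \<Longrightarrow> W j = 0"
  shows "(\<Sum>u\<in>{lo<..t}. send_weight a W T C lo t u) \<le> real m * weight W T C lo t"
proof -
  let ?D = "firsts T C lo t"
  have "(\<Sum>u\<in>{lo<..t}. send_weight a W T C lo t u) \<le>
      (\<Sum>u\<in>{lo<..t}. \<Sum>s\<in>?D. if first_sends T C s u then W (bin T C s t) else 0)"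
    by (intro sum_mono) (simp add: send_weight_def)
  also have "\<dots> = (\<Sum>s\<in>?D. \<Sum>u\<in>{lo<..t}. if first_sends T C s u then W (bin T C s t) else 0)"
    by (rule sum.swap)
  also have "\<dots> \<le> (\<Sum>s\<in>?D. real m * W (bin T C s t))"
  proof (rule sum_mono)
    fix s assume s: "s \<in> ?D"
    have "{u \<in> {lo<..t}. first_sends T C s u} = {u \<in> {s..t}. first_sends T C s u}"
      using firstsD[OF s] by (auto simp: first_sends_def)
    then have "(\<Sum>u\<in>{lo<..t}. if first_sends T C s u then W (bin T C s t) else 0) =
        real (bin T C s t) * W (bin T C s t)"
      using firstsD[OF s] bin_eq_card[of s T C t]
      by (simp flip: sum.inter_filter)
    also have "\<dots> \<le> real m * W (bin T C s t)"
      using assms by (cases "m < bin T C s t") (auto intro!: mult_right_mono)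
    finally show "(\<Sum>u\<in>{lo<..t}. if first_sends T C s u then W (bin T C s t) else 0) \<le> real m * W (bin T C s t)" .
  qed
  finally show ?thesis by (simp add: weight_def sum_distrib_left)
qed

text \<open>Every unstuck ball is charged to the step at which it became unstuck; these steps are distinct.\<close>
lemma weight_le_stuck_weight:
  assumes ok: "choice_ok T" and W: "\<And>j. 0 \<le> W j" "\<And>j. W j \<le> a"
  shows "weight W T C lo t \<le> stuck_weight W T C lo t +
    (\<Sum>u\<in>{lo<..t}. if silent T (other C) u then send_weight a W T C lo t u else 0)"
proof -
  let ?D = "firsts T C lo t"
  define U where "U = {s \<in> ?D. Newborn s 0 \<notin> stuck_in T t C}"
  have "\<forall>s\<in>U. \<exists>u. s \<le> u \<and> u \<le> t \<and> Newborn s 0 \<in> unstick T u (stuck_in T (u - 1)) C"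
  proof
    fix s assume "s \<in> U"
    then show "\<exists>u. s \<le> u \<and> u \<le> t \<and> Newborn s 0 \<in> unstick T u (stuck_in T (u - 1)) C"
      using unstuck_imp_unstick[of s t 0 T C] firstsD[of s T C lo t] by (auto simp: U_def)
  qed
  then obtain \<tau> where \<tau>: "\<And>s. s \<in> U \<Longrightarrow> s \<le> \<tau> s \<and> \<tau> s \<le> t \<and> Newborn s 0 \<in> unstick T (\<tau> s) (stuck_in T (\<tau> s - 1)) C"
    by metis
  have fin: "finite U" by (auto simp: U_def)
  have inj: "inj_on \<tau> U"
  proof (rule inj_onI)
    fix s s' assume "s \<in> U" "s' \<in> U" "\<tau> s = \<tau> s'"
    then have "Newborn s 0 = Newborn s' 0"
      using \<tau> unstickD(3)[OF ok] by (metis singletonD)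
    then show "s = s'" by simp
  qed
  have a: "0 \<le> a" using W(1)[of 0] W(2)[of 0] by linarith
  have 1: "W (bin T C s t) \<le> send_weight a W T C lo t (\<tau> s)" if "s \<in> U" for s
  proof -
    have s: "s \<in> ?D" using that by (simp add: U_def)
    have "first_sends T C s (\<tau> s)"
      using unstickD(2)[OF ok] \<tau>[OF that] first_in_sends_iff[of s T C] firstsD[OF s] by blast
    then have "W (bin T C s t) = (\<Sum>s\<in>{s}. if first_sends T C s (\<tau> s) then W (bin T C s t) else 0)"
      by simp
    then have "W (bin T C s t) = (if first_sends T C s (\<tau> s) then W (bin T C s t) else 0)"
      by simp
    also have "\<dots> \<le> (\<Sum>s'\<in>?D. if first_sends T C s' (\<tau> s) then W (bin T C s' t) else 0)"
      using W s by (intro member_le_sum) auto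
    finally show ?thesis using W by (simp add: send_weight_def)
  qed
  have "weight W T C lo t = stuck_weight W T C lo t + (\<Sum>s\<in>U. W (bin T C s t))"
    unfolding U_def by (subst sum.inter_filter) 
      (auto simp: weight_def stuck_weight_def simp flip: sum.distrib intro!: sum.cong)
  also have "(\<Sum>s\<in>U. W (bin T C s t)) \<le> (\<Sum>s\<in>U. send_weight a W T C lo t (\<tau> s))"
    by (intro sum_mono 1)
  also have "\<dots> = (\<Sum>u\<in>\<tau> ` U. send_weight a W T C lo t u)"
    by (simp add: sum.reindex[OF inj])
  also have "\<dots> = (\<Sum>u\<in>\<tau> ` U. if silent T (other C) u then send_weight a W T C lo t u else 0)"
    using unstickD(1)[OF ok] \<tau> by (intro sum.cong) auto
  also have "\<dots> \<le> (\<Sum>u\<in>{lo<..t}. if silent T (other C) u then send_weight a W T C lo t u else 0)"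
  proof (rule sum_mono2)
    show "\<tau> ` U \<subseteq> {lo<..t}" using \<tau> by (fastforce simp: U_def dest: firstsD)
  qed (auto intro!: send_weight_bounds W a)
  finally show ?thesis by simp
qed

lemma silent_imp_no_coin:
  assumes "silent T C (Suc t)" "s \<in> firsts T C lo t" "Newborn s 0 \<in> stuck_in T t C"
  shows "\<not> coin T C (Newborn s 0, bin T C s t, Suc t)"
proof
  assume "coin T C (Newborn s 0, bin T C s t, Suc t)"
  then have "Newborn s 0 \<in> ej_sends (stream T C) (Suc t)"
    using firstsD[OF assms(2)] by (subst first_in_sends_iff) (auto simp: first_sends_def)
  then have "Newborn s 0 \<in> stucksend T (Suc t) (stuck_in T t) C"
    using assms(3) by (auto simp: stucksend_def newstuck_def)
  then show False using assms(1) by (auto simp: silent_def)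
qed

text \<open>A newborn ball is stuck when it sends from bin 0, where sending is almost surely
  certain. Thus a birth in one stream blocks all unsticking in the other, which makes the starting
  window safe.\<close>

lemma not_silent_if_births:
  assumes "1 \<le> births T C u" "1 \<le> u" "coin T C (Newborn u 0, 0, u)"
  shows "\<not> silent T C u"
proof -
  have "Newborn u 0 \<in> ej_sends (stream T C) u"
    using assms by (subst first_in_sends_iff) (auto simp: first_sends_def bin_def)
  then have "Newborn u 0 \<in> stucksend T u (stuck_in T (u - 1)) C"
    using assms by (auto simp: stucksend_def newstuck_def newborns_def)
  then show ?thesis by (auto simp: silent_def)
qed

lemma stuck_nonempty:
  assumes "0 < stuck_weight W T C lo t"
  shows "stuck T t \<noteq> {}"
proof -
  have "\<exists>s. Newborn s 0 \<in> stuck_in T t C"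
  proof (rule ccontr)
    assume "\<not> ?thesis"
    then have "stuck_weight W T C lo t = 0" by (auto simp: stuck_weight_def intro!: sum.neutral)
    then show False using assms by simp
  qed
  then show ?thesis by (auto simp: stuck_def)
qed

text \<open>Causality is only needed with respect to coins: the supermartingale argument resamples
  coins of a single step, so all other sources of randomness are required to agree at all
  times.\<close>

definition agree_upto :: "nat \<Rightarrow> two_stream \<Rightarrow> two_stream \<Rightarrow> bool" where
  "agree_upto n T T' \<longleftrightarrow> choice T = choice T' \<and>
     (\<forall>C. births T C = births T' C \<and> ej_initial (stream T C) = ej_initial (stream T' C) \<and>
       (\<forall>b j s. s \<le> n \<longrightarrow> coin T C (b, j, s) = coin T' C (b, j, s)))"

lemma agree_uptoD:
  assumes "agree_upto n T T'"
  shows "choice T = choice T'" "births T C = births T' C"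
    "ej_initial (stream T C) = ej_initial (stream T' C)"
    "s \<le> n \<Longrightarrow> coin T C (b, j, s) = coin T' C (b, j, s)"
  using assms by (auto simp: agree_upto_def)

lemma agree_bins:
  assumes "agree_upto n T T'" "t \<le> n"
  shows "ej_bins (stream T C) t = ej_bins (stream T' C) t"
  using assms(2)
proof (induction t)
  case 0
  then show ?case using agree_uptoD(3)[OF assms(1), of C] by (simp cong: if_cong)
next
  case (Suc t)
  have "newborns (stream T C) (Suc t) = newborns (stream T' C) (Suc t)"
    using agree_uptoD(2)[OF assms(1), of C] by (simp add: newborns_def)
  then show ?case using Suc agree_uptoD(4)[OF assms(1), of "Suc t" C]
    by (auto simp: ej_step_def add_newborns_def fun_eq_iff)
qed

lemma agree_sends:
  assumes "agree_upto n T T'" "t \<le> n"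
  shows "ej_sends (stream T C) t = ej_sends (stream T' C) t"
  using agree_bins[OF assms(1), of "t - 1" C] assms(2) agree_uptoD(4)[OF assms(1), of t C]
    agree_uptoD(2)[OF assms(1), of C]
  by (simp add: ej_sends_def add_newborns_def newborns_def)

lemma agree_stuck_in:
  assumes "agree_upto n T T'" "t \<le> n"
  shows "stuck_in T t = stuck_in T' t"
  using assms(2)
proof (induction t)
  case (Suc t)
  have ns: "newstuck T (Suc t) S = newstuck T' (Suc t) S" for S
    using agree_uptoD(2)[OF assms(1)] by (simp add: newstuck_def newborns_def fun_eq_iff)
  have ss: "stucksend T (Suc t) S = stucksend T' (Suc t) S" for S
    using ns agree_sends[OF assms(1) Suc.prems] by (simp add: stucksend_def fun_eq_iff)
  show ?case using Suc by (simp add: ns ss unstick_def agree_uptoD(1)[OF assms(1)] cong: if_cong)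
qed simp

lemma agree_silent:
  assumes "agree_upto n T T'" "t \<le> n"
  shows "silent T C t = silent T' C t"
  using agree_stuck_in[OF assms(1), of "t - 1"] agree_sends[OF assms, of C] assms(2)
    agree_uptoD(2)[OF assms(1), of C]
  by (simp add: silent_def stucksend_def newstuck_def newborns_def)

lemma pos_cong:
  assumes "\<And>j u. s \<le> u \<Longrightarrow> u < s + a \<Longrightarrow> ej_coin Y (b, j, u) = ej_coin Y' (b, j, u)"
  shows "pos Y b s a = pos Y' b s a"
  using assms by (induction a) auto

lemma agree_bin:
  assumes "agree_upto n T T'" "t \<le> n"
  shows "bin T C s t = bin T' C s t"
  unfolding bin_def using assms by (intro pos_cong agree_uptoD(4)[OF assms(1)]) auto

lemma agree_stuck_weight:
  assumes "agree_upto n T T'" "t \<le> n"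
  shows "stuck_weight W T C lo t = stuck_weight W T' C lo t"
  unfolding stuck_weight_def firsts_def agree_uptoD(2)[OF assms(1)] agree_stuck_in[OF assms]
    agree_bin[OF assms] ..

section \<open>The probability space\<close>

definition has_law :: "('c \<Rightarrow> 'd) \<Rightarrow> 'c measure \<Rightarrow> 'd measure \<Rightarrow> bool" where
  "has_law X M N \<longleftrightarrow> X \<in> measurable M N \<and> distr M N X = N"

lemma has_law_compose:
  assumes "has_law X M N" "has_law Y N L"
  shows "has_law (\<lambda>\<omega>. Y (X \<omega>)) M L"
  using assms distr_distr[of Y N L X M] unfolding has_law_def by (auto simp: comp_def)

lemma has_law_fst:
  assumes "prob_space M" "prob_space N"
  shows "has_law fst (M \<Otimes>\<^sub>M N) M"
proof -
  interpret N: prob_space N by fact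
  have "distr (M \<Otimes>\<^sub>M N) M fst = M"
  proof (rule measure_eqI)
    fix A assume A: "A \<in> sets (distr (M \<Otimes>\<^sub>M N) M fst)"
    then have "fst -` A \<inter> space (M \<Otimes>\<^sub>M N) = A \<times> space N"
      by (auto simp: space_pair_measure dest: sets.sets_into_space)
    with A show "emeasure (distr (M \<Otimes>\<^sub>M N) M fst) A = emeasure M A"
      by (simp add: emeasure_distr N.emeasure_pair_measure_Times N.emeasure_space_1)
  qed simp
  then show ?thesis by (simp add: has_law_def)
qed

lemma has_law_snd:
  assumes "prob_space M" "prob_space N"
  shows "has_law snd (M \<Otimes>\<^sub>M N) N"
proof -
  interpret M: prob_space M by fact
  interpret N: prob_space N by fact
  have "distr (M \<Otimes>\<^sub>M N) N snd = N"
  proof (rule measure_eqI)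
    fix A assume A: "A \<in> sets (distr (M \<Otimes>\<^sub>M N) N snd)"
    then have "snd -` A \<inter> space (M \<Otimes>\<^sub>M N) = space M \<times> A"
      by (auto simp: space_pair_measure dest: sets.sets_into_space)
    with A show "emeasure (distr (M \<Otimes>\<^sub>M N) N snd) A = emeasure N A"
      by (simp add: emeasure_distr N.emeasure_pair_measure_Times M.emeasure_space_1)
  qed simp
  then show ?thesis by (simp add: has_law_def)
qed

lemma has_law_PiM_component:
  assumes "\<And>i. i \<in> I \<Longrightarrow> prob_space (M i)" "i \<in> I"
  shows "has_law (\<lambda>x. x i) (PiM I M) (M i)"
  using distr_PiM_component[OF assms] assms(2) by (simp add: has_law_def)

lemma has_law_AE:
  assumes "has_law X M N" "AE x in N. P x"
  shows "AE \<omega> in M. P (X \<omega>)"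
proof -
  have X: "X \<in> measurable M N" and "distr M N X = N"
    using assms(1) by (auto simp: has_law_def)
  then have "AE x in distr M N X. P x" using assms(2) by metis
  with X show ?thesis by (rule AE_distrD)
qed

lemma has_law_nn_integral:
  assumes "has_law X M N" "f \<in> borel_measurable N"
  shows "(\<integral>\<^sup>+\<omega>. f (X \<omega>) \<partial>M) = (\<integral>\<^sup>+x. f x \<partial>N)"
  using nn_integral_distr[of X M N f] assms by (simp add: has_law_def)

lemma prob_space_ej_measure: "prob_space (ej_measure \<mu> p)"
  unfolding ej_measure_def
  by (intro prob_space_pair prob_space_PiM) (auto simp: measure_pmf.prob_space_axioms)

lemma has_law_ej:
  shows "1 \<le> s \<Longrightarrow> has_law (\<lambda>Y. ej_births Y s) (ej_measure \<mu> p) (measure_pmf (poisson_pmf \<mu>))"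
    and "has_law (\<lambda>Y. ej_coin Y (b, j, u)) (ej_measure \<mu> p) (measure_pmf (bernoulli_pmf (p j)))"
proof -
  let ?I = "\<Pi>\<^sub>M j\<in>{1..}. measure_pmf (poisson_pmf (\<mu> / p j))"
  let ?B = "\<Pi>\<^sub>M t\<in>{1..}. measure_pmf (poisson_pmf \<mu>)"
  let ?C = "\<Pi>\<^sub>M (b :: ej_ball, j, t :: nat)\<in>UNIV. measure_pmf (bernoulli_pmf (p j))"
  have P: "prob_space ?I" "prob_space ?B" "prob_space ?C"
    by (auto intro!: prob_space_PiM measure_pmf.prob_space_axioms)
  have S: "has_law snd (?I \<Otimes>\<^sub>M (?B \<Otimes>\<^sub>M ?C)) (?B \<Otimes>\<^sub>M ?C)"
    by (intro has_law_snd P prob_space_pair)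
  have "has_law (\<lambda>x. x s) ?B (measure_pmf (poisson_pmf \<mu>))" if "1 \<le> s"
    using that has_law_PiM_component[of "{1..}" "\<lambda>_. measure_pmf (poisson_pmf \<mu>)" s]
    by (auto simp: measure_pmf.prob_space_axioms)
  then show "has_law (\<lambda>Y. ej_births Y s) (ej_measure \<mu> p) (measure_pmf (poisson_pmf \<mu>))" if "1 \<le> s"
    unfolding ej_measure_def ej_births_def
    using has_law_compose[OF has_law_compose[OF S has_law_fst[OF P(2,3)]]] that by blast
  have "has_law (\<lambda>x. x (b, j, u)) ?C (measure_pmf (bernoulli_pmf (p j)))"
    using has_law_PiM_component[of UNIV "\<lambda>(b :: ej_ball, j, t :: nat). measure_pmf (bernoulli_pmf (p j))" "(b, j, u)"]
    by (auto simp: measure_pmf.prob_space_axioms)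
  then show "has_law (\<lambda>Y. ej_coin Y (b, j, u)) (ej_measure \<mu> p) (measure_pmf (bernoulli_pmf (p j)))"
    unfolding ej_measure_def ej_coin_def
    using has_law_compose[OF has_law_compose[OF S has_law_snd[OF P(2,3)]]] by blast
qed

lemma has_law_stream: "has_law (\<lambda>T. stream T C) (two_stream_measure lam p) (ej_measure (lam / 2) p)"
  and has_law_choice: "finite S \<Longrightarrow> S \<noteq> {} \<Longrightarrow>
    has_law (\<lambda>T. choice T (t, S)) (two_stream_measure lam p) (measure_pmf (pmf_of_set S))"
proof -
  let ?E = "ej_measure (lam / 2) p"
  let ?I = "{(t :: nat, S :: ej_ball set). finite S \<and> S \<noteq> {}}"
  let ?C = "\<Pi>\<^sub>M (t :: nat, S :: ej_ball set)\<in>?I. measure_pmf (pmf_of_set S)"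
  have P: "prob_space ?E" "prob_space ?C"
    by (auto intro!: prob_space_PiM measure_pmf.prob_space_axioms prob_space_ej_measure)
  have S: "has_law snd (?E \<Otimes>\<^sub>M (?E \<Otimes>\<^sub>M ?C)) (?E \<Otimes>\<^sub>M ?C)"
    by (intro has_law_snd P prob_space_pair)
  show "has_law (\<lambda>T. stream T C) (two_stream_measure lam p) ?E"
    unfolding two_stream_measure_def
    using has_law_fst[OF P(1) prob_space_pair[OF P]] has_law_compose[OF S has_law_fst[OF P]]
    by (cases C) auto
  assume "finite S" "S \<noteq> {}"
  then have "has_law (\<lambda>x. x (t, S)) ?C (measure_pmf (pmf_of_set S))"
    using has_law_PiM_component[of ?I "\<lambda>(t :: nat, S :: ej_ball set). measure_pmf (pmf_of_set S)" "(t, S)"]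
    by (auto simp: measure_pmf.prob_space_axioms)
  then show "has_law (\<lambda>T. choice T (t, S)) (two_stream_measure lam p) (measure_pmf (pmf_of_set S))"
    unfolding two_stream_measure_def choice_def
    using has_law_compose[OF has_law_compose[OF S has_law_snd[OF P]]] by blast
qed

text \<open>Countability turns quantifiers over balls, and over lists of balls, into measurable
  operations.\<close>

instance ej_ball :: countable
  by countable_datatype

locale jammed =
  fixes lam :: real and p :: "nat \<Rightarrow> real"
  assumes lam_pos: "0 < lam"
    and send: "send_sequence p"
    and p0: "p 0 = 1"
begin

abbreviation TS :: "two_stream measure" where
  "TS \<equiv> two_stream_measure lam p"

sublocale TS: prob_space TS
  by (rule prob_space_two_stream_measure)

lemma p_bounds: "0 < p j" "p j \<le> 1"
  using send by (auto simp: send_sequence_def)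

lemma has_law_births: "1 \<le> s \<Longrightarrow> has_law (\<lambda>T. births T C s) TS (measure_pmf (poisson_pmf (lam / 2)))"
  by (rule has_law_compose[OF has_law_stream has_law_ej(1)])

lemma has_law_coin: "has_law (\<lambda>T. coin T C (b, j, u)) TS (measure_pmf (bernoulli_pmf (p j)))"
  by (rule has_law_compose[OF has_law_stream has_law_ej(2)])

section \<open>Measurability of the observables\<close>

lemma measurable_births [measurable]:
  "1 \<le> s \<Longrightarrow> (\<lambda>T. births T C s) \<in> measurable TS (count_space UNIV)"
  using has_law_births[of s C] by (simp add: has_law_def)

lemma measurable_coin [measurable]: "(\<lambda>T. coin T C x) \<in> measurable TS (count_space UNIV)"
  using has_law_coin[of C "fst x" "fst (snd x)" "snd (snd x)"] by (simp add: has_law_def)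

lemma measurable_choice:
  "finite S \<Longrightarrow> S \<noteq> {} \<Longrightarrow> (\<lambda>T. choice T (t, S)) \<in> measurable TS (count_space UNIV)"
  using has_law_choice[of S t lam p] by (simp add: has_law_def)

lemma measurable_pos [measurable]: "(\<lambda>T. pos (stream T C) b s a) \<in> measurable TS (count_space UNIV)"
proof (induction a)
  case (Suc a)
  note [measurable] = Suc
  have "(\<lambda>T. coin T C (b, pos (stream T C) b s a, s + a)) \<in> measurable TS (count_space UNIV)"
    by (rule measurable_compose_countable[OF measurable_coin Suc])
  note [measurable] = this
  show ?case by simp
qed simp

lemma measurable_coin_pos [measurable]:
  "(\<lambda>T. coin T C (b, pos (stream T C) b s a, u)) \<in> measurable TS (count_space UNIV)"
  by (rule measurable_compose_countable[OF measurable_coin measurable_pos])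

lemma measurable_bin [measurable]: "(\<lambda>T. bin T C s t) \<in> measurable TS (count_space UNIV)"
  unfolding bin_def by measurable

lemma measurable_coin_bin [measurable]:
  "(\<lambda>T. coin T C (Newborn s 0, bin T C s t, u)) \<in> measurable TS (count_space UNIV)"
  unfolding bin_def by measurable

lemma measurable_in_stuck [measurable]: "Measurable.pred TS (\<lambda>T. b \<in> stuck_in T t C)"
  and measurable_in_stucksend: "Measurable.pred TS (\<lambda>T. b \<in> stucksend T (Suc t) (stuck_in T t) C)"
proof -
  have stucksend: "Measurable.pred TS (\<lambda>T. b \<in> stucksend T (Suc t) (stuck_in T t) C)"
    and newstuck: "Measurable.pred TS (\<lambda>T. b \<in> newstuck T (Suc t) (stuck_in T t) C)"
    if IH: "\<And>b C. Measurable.pred TS (\<lambda>T. b \<in> stuck_in T t C)" for b t C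
  proof -
    note [measurable] = IH
    have "Measurable.pred TS (\<lambda>T. b \<in> newborns (stream T C) (Suc t))"
      unfolding newborns_def by simp measurable
    note [measurable] = this
    show newstuck: "Measurable.pred TS (\<lambda>T. b \<in> newstuck T (Suc t) (stuck_in T t) C)"
      unfolding newstuck_def Un_iff by measurable
    note [measurable] = this
    show "Measurable.pred TS (\<lambda>T. b \<in> stucksend T (Suc t) (stuck_in T t) C)"
    proof (cases "\<exists>s k. b = Newborn s k \<and> 1 \<le> s")
      case True
      then obtain s k where b: "b = Newborn s k" and s: "1 \<le> s" by auto
      note [measurable] = measurable_births[OF s, of C]
      show ?thesis
        unfolding b stucksend_def Int_iff Newborn_in_sends_iff[OF s] using newstuck[unfolded b] by measurable
    next
      case False
      then have "b \<notin> stucksend T (Suc t) (stuck_in T t) C" for T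
        using stuck_in_newborn[of b T t C] by (auto simp: stucksend_def newstuck_def newborns_def)
      then show ?thesis by simp
    qed
  qed
  have stuck: "Measurable.pred TS (\<lambda>T. b \<in> stuck_in T t C)" for b t C
  proof (induction t arbitrary: b C)
    case (Suc t)
    note [measurable] = stucksend[OF Suc] newstuck[OF Suc]
    let ?S = "\<lambda>T C. stucksend T (Suc t) (stuck_in T t) C"
    \<comment> \<open>The possible values of \<open>stucksend\<close> are finite sets, enumerated
      here by lists, of which there are only countably many. The conjunct
      \<open>xs \<noteq> []\<close> keeps \<open>(Suc t, set xs)\<close> inside the index set of the
      product measure.\<close>
    have [measurable]: "Measurable.pred TS (\<lambda>T. xs \<noteq> [] \<and> ?S T C = set xs \<and> choice T (Suc t, set xs) = b)"
      for xs :: "ej_ball list"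
    proof (cases "xs = []")
      case False
      then have [measurable]: "(\<lambda>T. choice T (Suc t, set xs)) \<in> measurable TS (count_space UNIV)"
        by (intro measurable_choice) auto
      show ?thesis unfolding set_eq_iff by measurable
    qed simp
    have "b \<in> unstick T (Suc t) (stuck_in T t) C \<longleftrightarrow> (\<forall>b'. b' \<notin> ?S T (other C)) \<and>
        (\<exists>xs. xs \<noteq> [] \<and> ?S T C = set xs \<and> choice T (Suc t, set xs) = b)" for T
    proof -
      have "finite (?S T C)" by (auto simp: stucksend_def newstuck_def newborns_def finite_stuck_in)
      then obtain xs where xs: "?S T C = set xs" using finite_list by metis
      then show ?thesis by (auto simp: unstick_def split: if_splits)
    qed
    then have [measurable]: "Measurable.pred TS (\<lambda>T. b \<in> unstick T (Suc t) (stuck_in T t) C)"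
      by (simp only:) measurable
    show ?case by simp
  qed simp
  show "Measurable.pred TS (\<lambda>T. b \<in> stuck_in T t C)" by (rule stuck)
  show "Measurable.pred TS (\<lambda>T. b \<in> stucksend T (Suc t) (stuck_in T t) C)" by (rule stucksend[OF stuck])
qed

lemma measurable_silent [measurable]: "Measurable.pred TS (\<lambda>T. silent T C (Suc t))"
proof -
  note [measurable] = measurable_in_stucksend
  show ?thesis unfolding silent_def diff_Suc_1 set_eq_iff empty_iff by measurable
qed

lemma measurable_in_firsts [measurable]: "Measurable.pred TS (\<lambda>T. s \<in> firsts T C lo t)"
proof (cases "1 \<le> s")
  case True
  note [measurable] = measurable_births[OF True, of C]
  show ?thesis unfolding firsts_def by simp
next
  case False
  then have "s \<notin> firsts T C lo t" for T by (auto simp: firsts_def)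
  then show ?thesis by simp
qed

lemma sum_firsts: "(\<Sum>s\<in>firsts T C lo t. f s) = (\<Sum>s\<in>{lo<..t}. if s \<in> firsts T C lo t then f s else 0)"
proof -
  have "{s \<in> {lo<..t}. s \<in> firsts T C lo t} = firsts T C lo t" by (auto simp: firsts_def)
  then show ?thesis
    using sum.inter_filter[of "{lo<..t}" f "\<lambda>s. s \<in> firsts T C lo t"] by simp
qed

lemma measurable_W_bin: "(\<lambda>T. (W :: nat \<Rightarrow> real) (bin T C s t)) \<in> borel_measurable TS"
  by (rule measurable_compose[OF measurable_bin]) simp

lemma measurable_weight [measurable]: "(\<lambda>T. weight W T C lo t) \<in> borel_measurable TS"
  unfolding weight_def sum_firsts using measurable_W_bin by measurable

lemma measurable_stuck_weight [measurable]: "(\<lambda>T. stuck_weight W T C lo t) \<in> borel_measurable TS"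
  unfolding stuck_weight_def sum_firsts using measurable_W_bin by measurable

lemma measurable_send_weight [measurable]: "(\<lambda>T. send_weight a W T C lo t u) \<in> borel_measurable TS"
  unfolding send_weight_def sum_firsts first_sends_def using measurable_W_bin by measurable

lemma nn_integral_coin:
  "(\<integral>\<^sup>+T. f (coin T C (b, j, u)) \<partial>TS) = f True * ennreal (p j) + f False * ennreal (1 - p j)"
  using p_bounds[of j] has_law_nn_integral[OF has_law_coin, of f j C b u]
  by (simp add: less_imp_le)

text \<open>The probability that a Poisson variable of mean \<open>lam / 2\<close> is positive, that
  is, that a stream has a newborn ball at a given step.\<close>

definition \<beta> :: real where
  "\<beta> = 1 - exp (- (lam / 2))"

lemma \<beta>_bounds: "0 < \<beta>" "\<beta> < 1"
  using lam_pos by (auto simp: \<beta>_def)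

lemma nn_integral_births:
  assumes "1 \<le> s"
  shows "(\<integral>\<^sup>+T. f (1 \<le> births T C s) \<partial>TS) = f True * ennreal \<beta> + f False * ennreal (1 - \<beta>)"
proof -
  let ?P = "poisson_pmf (lam / 2)"
  have r: "0 \<le> lam / 2" using lam_pos by simp
  have 0: "measure_pmf.prob ?P {0} = exp (- (lam / 2))"
    using lam_pos by (simp add: measure_pmf_single)
  have "{n :: nat. 1 \<le> n} = UNIV - {0}" by auto
  then have 1: "measure_pmf.prob ?P {n. 1 \<le> n} = \<beta>"
    using measure_pmf.prob_compl[of "{0}" ?P] 0 by (simp add: \<beta>_def)
  have "(\<integral>\<^sup>+T. f (1 \<le> births T C s) \<partial>TS) = (\<integral>\<^sup>+n. f (1 \<le> n) \<partial>?P)"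
    by (rule has_law_nn_integral[OF has_law_births[OF assms], of "\<lambda>n. f (1 \<le> n)"]) simp
  also have "\<dots> = (\<integral>\<^sup>+n. f True * indicator {n. 1 \<le> n} n + f False * indicator {0} n \<partial>?P)"
    by (intro nn_integral_cong) (auto simp: indicator_def)
  also have "\<dots> = f True * emeasure ?P {n. 1 \<le> n} + f False * emeasure ?P {0}"
    by (subst nn_integral_add) (auto simp: nn_integral_cmult)
  finally show ?thesis
    using 0 1 by (simp add: measure_pmf.emeasure_eq_measure \<beta>_def)
qed

lemma AE_choice_ok: "AE T in TS. choice_ok T"
proof -
  have "AE T in TS. xs \<noteq> [] \<longrightarrow> choice T (t, set xs) \<in> set xs" for t and xs :: "ej_ball list"
  proof (cases "xs = []")
    case False
    then have "AE x in pmf_of_set (set xs). x \<in> set xs"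
      using AE_measure_pmf[of "pmf_of_set (set xs)"] by simp
    from has_law_AE[OF has_law_choice this] False show ?thesis by simp
  qed simp
  then have "AE T in TS. \<forall>t xs. xs \<noteq> [] \<longrightarrow> choice T (t, set xs) \<in> set xs"
    by (simp add: AE_all_countable)
  then show ?thesis
  proof eventually_elim
    case (elim T)
    show ?case unfolding choice_ok_def
    proof (intro allI impI)
      fix t and S :: "ej_ball set" assume S: "finite S" "S \<noteq> {}"
      obtain xs where "S = set xs" using finite_list[OF S(1)] by auto
      then show "choice T (t, S) \<in> S" using elim S(2) by auto
    qed
  qed
qed

lemma AE_bin0_sends: "AE T in TS. \<forall>C b u. coin T C (b, 0, u)"
proof -
  have "AE T in TS. coin T C (b, 0, u)" for C b u
  proof (rule has_law_AE[OF has_law_coin])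
    have "False \<notin> set_pmf (bernoulli_pmf (p 0))"
      unfolding set_pmf_iff p0 by simp
    then show "AE x in bernoulli_pmf (p 0). x"
      unfolding AE_measure_pmf_iff by (metis (full_types))
  qed
  then have "AE T in TS. \<forall>b u. coin T StreamA (b, 0, u)" "AE T in TS. \<forall>b u. coin T StreamB (b, 0, u)"
    unfolding AE_all_countable by blast+
  then show ?thesis
  proof eventually_elim
    case (elim T)
    show ?case using elim by (metis stream_label.exhaust)
  qed
qed

lemma measurable_mix [measurable (raw)]:
  assumes "f \<in> measurable N TS" "g \<in> measurable N TS"
  shows "(\<lambda>x. mix KB KC (f x) (g x)) \<in> measurable N TS"
  using measurable_compose[OF measurable_Pair[OF assms] resamplingD(2)[OF resampling_mix, of KB KC]] by simp

lemma nn_integral_mix: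
  "F \<in> borel_measurable TS \<Longrightarrow> (\<integral>\<^sup>+T. F T \<partial>TS) = (\<integral>\<^sup>+T. \<integral>\<^sup>+T'. F (mix KB KC T T') \<partial>TS \<partial>TS)"
  by (rule resamplingD(3)[OF resampling_mix])

text \<open>Independence in its working form: \<open>H\<close> reads only resampled coordinates and
  \<open>G\<close> only the others, so the double integral factorizes.\<close>

lemma nn_integral_mult_mix:
  assumes [measurable]: "G \<in> borel_measurable TS" "H \<in> borel_measurable TS"
    and G: "\<And>T T'. G (mix KB KC T T') = G T" and H: "\<And>T T'. H (mix KB KC T T') = H T'"
  shows "(\<integral>\<^sup>+T. G T * H T \<partial>TS) = (\<integral>\<^sup>+T. G T \<partial>TS) * (\<integral>\<^sup>+T. H T \<partial>TS)"
proof -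
  have "(\<integral>\<^sup>+T. G T * H T \<partial>TS) = (\<integral>\<^sup>+T. \<integral>\<^sup>+T'. G T * H T' \<partial>TS \<partial>TS)"
    by (subst nn_integral_mix[of _ KB KC]) (auto simp: G H)
  also have "\<dots> = (\<integral>\<^sup>+T. G T * (\<integral>\<^sup>+T'. H T' \<partial>TS) \<partial>TS)"
    by (intro nn_integral_cong nn_integral_cmult) measurable
  also have "\<dots> = (\<integral>\<^sup>+T. G T \<partial>TS) * (\<integral>\<^sup>+T'. H T' \<partial>TS)"
    by (rule nn_integral_multc) measurable
  finally show ?thesis .
qed

end

section \<open>The law of a trajectory\<close>

context jammed
begin

primrec pos_prob :: "nat \<Rightarrow> nat \<Rightarrow> real" where
  "pos_prob 0 = (\<lambda>j. if j = 0 then 1 else 0)"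
| "pos_prob (Suc a) = (\<lambda>j. pos_prob a j * (1 - p j) + (if j = 0 then 0 else pos_prob a (j - 1) * p (j - 1)))"

lemma pos_prob_nonneg: "0 \<le> pos_prob a j"
  using p_bounds by (induction a arbitrary: j) (auto intro!: add_nonneg_nonneg mult_nonneg_nonneg simp: less_imp_le)

lemma nn_integral_pos:
  "(\<integral>\<^sup>+T. indicator {T. pos (stream T C) b s a = j} T \<partial>TS) = ennreal (pos_prob a j)"
proof (induction a arbitrary: j)
  case 0
  then show ?case by (simp add: indicator_def TS.emeasure_space_1)
next
  case (Suc a)
  let ?I = "\<lambda>j T. indicator {T. pos (stream T C) b s a = j} T :: ennreal"
  \<comment> \<open>The position at age \<open>a\<close> was decided by coins of steps before
    \<open>s + a\<close>, hence is independent of the coin of step \<open>s + a\<close> in any fixed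
    bin \<open>i\<close>.\<close>
  have *: "(\<integral>\<^sup>+T. ?I i T * indicator {T. coin T C (b, i, s + a) = v} T \<partial>TS) =
      ennreal (pos_prob a i) * (\<integral>\<^sup>+T. indicator {T. coin T C (b, i, s + a) = v} T \<partial>TS)" for i v
  proof (subst Suc.IH[symmetric], 
      rule nn_integral_mult_mix[where KB = "\<lambda>_. {}" and KC = "\<lambda>_. {(b, i, s + a)}"])
    fix T T'
    have "pos (stream (mix (\<lambda>_. {}) (\<lambda>_. {(b, i, s + a)}) T T') C) b s a = pos (stream T C) b s a"
      by (intro pos_cong) auto
    then show "?I i (mix (\<lambda>_. {}) (\<lambda>_. {(b, i, s + a)}) T T') = ?I i T"
      by (simp add: indicator_def)
  qed (auto simp: indicator_def)
  have c: "(\<integral>\<^sup>+T. indicator {T. coin T C (b, i, s + a) = v} T \<partial>TS) = ennreal (if v then p i else 1 - p i)" for i v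
    using nn_integral_coin[of "\<lambda>x. indicator {v} x" C b i "s + a"] p_bounds[of i]
    by (cases v) (auto simp: indicator_def)
  have "(\<integral>\<^sup>+T. indicator {T. pos (stream T C) b s (Suc a) = j} T \<partial>TS) =
     (\<integral>\<^sup>+T. ?I j T * indicator {T. coin T C (b, j, s + a) = False} T +
        (if j = 0 then 0 else ?I (j - 1) T * indicator {T. coin T C (b, j - 1, s + a) = True} T) \<partial>TS)"
    by (intro nn_integral_cong) (auto simp: indicator_def split: if_splits)
  also have "\<dots> = ennreal (pos_prob a j) * ennreal (1 - p j) +
      (if j = 0 then 0 else ennreal (pos_prob a (j - 1)) * ennreal (p (j - 1)))"
    using *[of j False] *[of "j - 1" True] c[of j False] c[of "j - 1" True]
    by (cases "j = 0") (simp_all add: nn_integral_add)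
  also have "\<dots> = ennreal (pos_prob (Suc a) j)"
    using p_bounds[of j] p_bounds[of "j - 1"] pos_prob_nonneg[of a]
    by (auto simp: ennreal_mult[symmetric] ennreal_plus[symmetric] less_imp_le simp del: ennreal_plus)
  finally show ?case .
qed

definition pos_cdf :: "nat \<Rightarrow> nat \<Rightarrow> real" where
  "pos_cdf a j = (\<Sum>i\<le>j. pos_prob a i)"

text \<open>The sum telescopes, as mass leaves the bins \<open>0, ..., j\<close> only through bin
  \<open>j\<close>.\<close>

lemma pos_cdf_Suc: "pos_cdf (Suc a) j = pos_cdf a j - p j * pos_prob a j"
  unfolding pos_cdf_def by (induction j) (auto simp: algebra_simps)

lemma pos_cdf_0: "pos_cdf 0 j = 1"
  unfolding pos_cdf_def by (induction j) auto

text \<open>A ball leaves each bin at most once, so \<open>p j\<close> times the expected time spent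
  in bin \<open>j\<close> is the probability of having left it.\<close>

lemma sum_pos_prob: "p j * (\<Sum>a<n. pos_prob a j) = 1 - pos_cdf n j"
  by (induction n) (auto simp: pos_cdf_0 pos_cdf_Suc algebra_simps)

lemma pos_cdf_nonneg: "0 \<le> pos_cdf a j"
  unfolding pos_cdf_def by (intro sum_nonneg pos_prob_nonneg)

lemma pos_cdf_mono: "i \<le> j \<Longrightarrow> pos_cdf a i \<le> pos_cdf a j"
  unfolding pos_cdf_def by (intro sum_mono2) (auto simp: pos_prob_nonneg)

lemma pos_cdf_antimono: "a \<le> b \<Longrightarrow> pos_cdf b j \<le> pos_cdf a j"
proof (induction rule: dec_induct)
  case (step n)
  have "0 \<le> p j * pos_prob n j" using p_bounds[of j] pos_prob_nonneg by simp
  then show ?case using step by (simp add: pos_cdf_Suc)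
qed simp

text \<open>The left-hand side is at most the expected time spent in the bins \<open>0, \<dots>, m\<close>.\<close>
lemma pos_cdf_le: "real n * pos_cdf n m \<le> (\<Sum>i\<le>m. 1 / p i)"
proof -
  have "real n * pos_cdf n m = (\<Sum>a<n. pos_cdf n m)" by simp
  also have "\<dots> \<le> (\<Sum>a<n. pos_cdf a m)" by (intro sum_mono pos_cdf_antimono) auto
  also have "\<dots> = (\<Sum>i\<le>m. \<Sum>a<n. pos_prob a i)" unfolding pos_cdf_def by (rule sum.swap)
  also have "\<dots> \<le> (\<Sum>i\<le>m. 1 / p i)"
  proof (rule sum_mono)
    fix i
    have "p i * (\<Sum>a<n. pos_prob a i) \<le> 1" using pos_cdf_nonneg by (simp add: sum_pos_prob)
    then show "(\<Sum>a<n. pos_prob a i) \<le> 1 / p i" using p_bounds[of i] by (simp add: field_simps)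
  qed
  finally show ?thesis .
qed

text \<open>By \<open>pos_cdf_le\<close> a ball of age \<open>n\<close> is beyond bin
  \<open>m\<close> with probability at least 1/2. Read over birth steps instead of ages, the sum is
  the expected weight that one ball per step brings into bin \<open>j\<close>.\<close>

lemma sum_pos_prob_ge:
  assumes "2 * (\<Sum>i\<le>m. 1 / p i) \<le> real n" "1 \<le> j" "j \<le> m" "n \<le> Suc k"
  shows "1 / 2 \<le> p j * (\<Sum>a\<in>{1..k}. pos_prob a j)"
proof -
  have "0 < (\<Sum>i\<le>m. 1 / p i)" using p_bounds by (intro sum_pos) auto
  then have n: "0 < real n" using assms(1) by linarith
  have "real n * pos_cdf n m \<le> real n * (1 / 2)" using pos_cdf_le[of n m] assms(1) by simp
  then have "pos_cdf n m \<le> 1 / 2" using n by (simp only: mult_le_cancel_left_pos)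
  then have "pos_cdf (Suc k) j \<le> 1 / 2"
    using pos_cdf_mono[OF assms(3), of n] pos_cdf_antimono[OF assms(4), of j] by linarith
  then have "1 / 2 \<le> p j * (\<Sum>a<Suc k. pos_prob a j)" by (simp only: sum_pos_prob)
  \<comment> \<open>The term \<open>a = 0\<close> vanishes: a ball of age 0 is in bin 0, and
    \<open>1 \<le> j\<close>.\<close>
  also have "(\<Sum>a<Suc k. pos_prob a j) = (\<Sum>a\<in>{1..k}. pos_prob a j)"
    using assms(2) by (subst lessThan_Suc_atMost, subst sum.atMost_shift) (auto simp: sum.shift_bounds_Suc_ivl intro!: sum.reindex_bij_witness[of _ "\<lambda>i. i - 1" Suc])
  finally show ?thesis .
qed

section \<open>Few balls in the slow bins are unlikely\<close>

lemma exp_minus_le: "exp (- x) \<le> 1 - x / 2" if "0 \<le> x" "x \<le> 1" for x :: real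
proof -
  have "1 \<le> (1 - x / 2) * (1 + x)" using that mult_right_mono[of x 1 x] by (simp add: algebra_simps)
  also have "\<dots> \<le> (1 - x / 2) * exp x" using that by (intro mult_left_mono) auto
  finally show ?thesis by (simp add: exp_minus field_simps)
qed

definition bin_weight :: "nat set \<Rightarrow> nat \<Rightarrow> real" where
  "bin_weight S j = (if j \<in> S then p j else 0)"

lemma measurable_bin_weight [measurable]: "(\<lambda>T. bin_weight S (bin T C s t)) \<in> borel_measurable TS"
  by (rule measurable_W_bin)

text \<open>This integrates \<open>exp (- x) \<le> 1 - x / 2\<close> at the weight divided by
  \<open>c\<close>, which lies between 0 and 1 because the bins in \<open>S\<close> are slow. Inside
  the integral the inequality is kept additive, as subtraction on \<open>ennreal\<close>
  truncates.\<close>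

lemma nn_integral_exp_bin_weight:
  assumes "finite S" "\<And>j. j \<in> S \<Longrightarrow> p j \<le> c" "0 < c"
  shows "\<exists>e\<ge>0. e \<le> 1 - (\<Sum>j\<in>S. p j * pos_prob (Suc t - s) j) / (2 * c) \<and>
    (\<integral>\<^sup>+T. ennreal (exp (- (bin_weight S (bin T C s t) / c))) \<partial>TS) = ennreal e"
proof -
  let ?I = "\<lambda>j T. indicator {T. bin T C s t = j} T :: ennreal"
  let ?e = "\<integral>\<^sup>+T. ennreal (exp (- (bin_weight S (bin T C s t) / c))) \<partial>TS"
  let ?g = "(\<Sum>j\<in>S. p j * pos_prob (Suc t - s) j) / (2 * c)"
  have g: "0 \<le> ?g"
    using assms(3) p_bounds pos_prob_nonneg by (auto intro!: divide_nonneg_pos sum_nonneg mult_nonneg_nonneg simp: less_imp_le)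
  have "?e + (\<Sum>j\<in>S. ennreal (p j / (2 * c)) * (\<integral>\<^sup>+T. ?I j T \<partial>TS)) =
      (\<integral>\<^sup>+T. ennreal (exp (- (bin_weight S (bin T C s t) / c))) + (\<Sum>j\<in>S. ennreal (p j / (2 * c)) * ?I j T) \<partial>TS)"
    by (simp add: nn_integral_add nn_integral_sum nn_integral_cmult)
  also have "\<dots> \<le> (\<integral>\<^sup>+T. 1 \<partial>TS)"
  proof (rule nn_integral_mono)
    fix T
    let ?b = "bin T C s t"
    have "(\<Sum>j\<in>S. ennreal (p j / (2 * c)) * ?I j T) = (\<Sum>j\<in>S. if j = ?b then ennreal (p j / (2 * c)) else 0)"
      by (intro sum.cong) (auto simp: indicator_def)
    also have "\<dots> = ennreal (bin_weight S ?b / (2 * c))"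
      using assms(1) by (simp add: bin_weight_def)
    finally have "ennreal (exp (- (bin_weight S ?b / c))) + (\<Sum>j\<in>S. ennreal (p j / (2 * c)) * ?I j T) =
       ennreal (exp (- (bin_weight S ?b / c)) + bin_weight S ?b / (2 * c))"
      using p_bounds[of ?b] assms(3) by (simp add: bin_weight_def)
    also have "\<dots> \<le> 1"
    proof -
      have "exp (- (bin_weight S ?b / c)) \<le> 1 - (bin_weight S ?b / c) / 2"
        using assms p_bounds[of ?b] by (intro exp_minus_le) (auto simp: bin_weight_def less_imp_le)
      then have "exp (- (bin_weight S ?b / c)) + bin_weight S ?b / (2 * c) \<le> 1"
        by simp
      then show ?thesis by (simp only: ennreal_le_1)
    qed
    finally show "ennreal (exp (- (bin_weight S ?b / c))) + (\<Sum>j\<in>S. ennreal (p j / (2 * c)) * ?I j T) \<le> 1" .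
  qed
  also have "\<dots> = 1" by (simp add: TS.emeasure_space_1)
  also have "(\<Sum>j\<in>S. ennreal (p j / (2 * c)) * (\<integral>\<^sup>+T. ?I j T \<partial>TS)) = ennreal ?g"
    using assms(3) p_bounds pos_prob_nonneg unfolding bin_def
    by (simp add: nn_integral_pos ennreal_mult[symmetric] less_imp_le sum_divide_distrib)
  finally have 1: "?e + ennreal ?g \<le> 1" .
  then obtain e where e: "?e = ennreal e" "0 \<le> e"
    by (cases ?e) (auto simp: top_unique)
  with 1 g have "e + ?g \<le> 1" by (simp add: ennreal_plus[symmetric] ennreal_le_1 del: ennreal_plus)
  with e show ?thesis by (intro exI[of _ e]) auto
qed

text \<open>For \<open>s \<le> w\<close> the factor does not read the birth count at
  \<open>s\<close>, so that it stays independent of a conditioning event about the births up to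
  \<open>w\<close>.\<close>

definition first_factor :: "real \<Rightarrow> nat set \<Rightarrow> stream_label \<Rightarrow> nat \<Rightarrow> nat \<Rightarrow> nat \<Rightarrow> two_stream \<Rightarrow> ennreal" where
  "first_factor c S C w t s T =
     (if s \<le> w \<or> 1 \<le> births T C s then ennreal (exp (- (bin_weight S (bin T C s t) / c))) else 1)"

lemma measurable_first_factor [measurable]:
  assumes "1 \<le> s"
  shows "first_factor c S C w t s \<in> borel_measurable TS"
proof -
  note [measurable] = measurable_births[OF assms, of C]
  have "(\<lambda>T. first_factor c S C w t s T) \<in> borel_measurable TS"
    unfolding first_factor_def by measurable
  then show ?thesis by simp
qed

text \<open>Presence with probability \<open>\<beta>\<close> turns a bound \<open>1 - g\<close> into
  \<open>1 - \<beta> * g \<le> exp (- (\<beta> * g))\<close>; for a ball that is certain to exist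
  this is only weaker.\<close>

lemma nn_integral_first_factor:
  assumes "finite S" "\<And>j. j \<in> S \<Longrightarrow> p j \<le> c" "0 < c" "1 \<le> s"
  shows "(\<integral>\<^sup>+T. first_factor c S C w t s T \<partial>TS) \<le>
    ennreal (exp (- (\<beta> * ((\<Sum>j\<in>S. p j * pos_prob (Suc t - s) j) / (2 * c)))))"
proof -
  note [measurable] = measurable_births[OF assms(4), of C]
  define g where "g = (\<Sum>j\<in>S. p j * pos_prob (Suc t - s) j) / (2 * c)"
  let ?f = "\<lambda>T. ennreal (exp (- (bin_weight S (bin T C s t) / c)))"
  have g: "0 \<le> g"
    unfolding g_def
    using assms(3) p_bounds pos_prob_nonneg by (auto intro!: divide_nonneg_pos sum_nonneg mult_nonneg_nonneg simp: less_imp_le)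
  obtain e' where e': "0 \<le> e'" "e' \<le> 1 - g" and f: "(\<integral>\<^sup>+T. ?f T \<partial>TS) = ennreal e'"
    using nn_integral_exp_bin_weight[where C = C and s = s and t = t, OF assms(1-3)] unfolding g_def by blast
  have e: "1 - \<beta> * g \<le> exp (- (\<beta> * g))" using exp_ge_add_one_self[of "- (\<beta> * g)"] by simp
  show ?thesis
  proof (cases "s \<le> w")
    case True
    have "1 - g \<le> 1 - \<beta> * g" using \<beta>_bounds g mult_right_mono[of \<beta> 1 g] by simp
    then show ?thesis using f True e e'
      by (simp add: first_factor_def g_def[symmetric] ennreal_leI)
  next
    case False
    have "(\<integral>\<^sup>+T. first_factor c S C w t s T \<partial>TS) = 
      (\<integral>\<^sup>+T. ?f T * indicator {True} (1 \<le> births T C s) + indicator {False} (1 \<le> births T C s) \<partial>TS)"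
      using False by (intro nn_integral_cong) (auto simp: first_factor_def)
    also have "\<dots> = (\<integral>\<^sup>+T. ?f T * indicator {True} (1 \<le> births T C s) \<partial>TS) + 
        (\<integral>\<^sup>+T. indicator {False} (1 \<le> births T C s) \<partial>TS)"
      by (rule nn_integral_add) measurable
    also have "(\<integral>\<^sup>+T. ?f T * indicator {True} (1 \<le> births T C s) \<partial>TS) =
        (\<integral>\<^sup>+T. ?f T \<partial>TS) * (\<integral>\<^sup>+T. indicator {True} (1 \<le> births T C s) \<partial>TS)"
    proof (rule nn_integral_mult_mix[where KB = "\<lambda>_. {s}" and KC = "\<lambda>_. {}"])
      fix T T'
      have "bin (mix (\<lambda>_. {s}) (\<lambda>_. {}) T T') C s t = bin T C s t"
        unfolding bin_def by (intro pos_cong) auto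
      then show "?f (mix (\<lambda>_. {s}) (\<lambda>_. {}) T T') = ?f T" by simp
      show "indicator {True} (1 \<le> births (mix (\<lambda>_. {s}) (\<lambda>_. {}) T T') C s) = (indicator {True} (1 \<le> births T' C s) :: ennreal)"
        by simp
    next
      show "(\<lambda>T. indicator {True} (1 \<le> births T C s)) \<in> borel_measurable TS" by measurable
    qed measurable
    also have "(\<integral>\<^sup>+T. indicator {True} (1 \<le> births T C s) \<partial>TS) = ennreal \<beta>"
      using nn_integral_births[OF assms(4), of "indicator {True}" C] by simp
    also have "(\<integral>\<^sup>+T. indicator {False} (1 \<le> births T C s) \<partial>TS) = ennreal (1 - \<beta>)"
      using nn_integral_births[OF assms(4), of "indicator {False}" C] by simp
    also have "(\<integral>\<^sup>+T. ?f T \<partial>TS) * ennreal \<beta> + ennreal (1 - \<beta>) = ennreal (e' * \<beta> + (1 - \<beta>))"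
      using e' \<beta>_bounds by (simp add: f ennreal_mult[symmetric] ennreal_plus[symmetric] del: ennreal_plus)
    also have "\<dots> \<le> ennreal (exp (- (\<beta> * g)))"
    proof (rule ennreal_leI)
      have "e' * \<beta> \<le> (1 - g) * \<beta>" using \<beta>_bounds e' by (intro mult_right_mono) auto
      then show "e' * \<beta> + (1 - \<beta>) \<le> exp (- (\<beta> * g))" using e by (simp add: algebra_simps)
    qed
    finally show ?thesis by (simp add: g_def)
  qed
qed

text \<open>The events on which attempts are conditioned. They see births up to \<open>w\<close> and
  nothing else, so all coins and all later births remain independent of them.\<close>

definition births_upto :: "nat \<Rightarrow> (two_stream \<Rightarrow> bool) \<Rightarrow> bool" where
  "births_upto w J \<longleftrightarrow> Measurable.pred TS J \<and>
     (\<forall>T T'. (\<forall>C s. s \<le> w \<longrightarrow> births T C s = births T' C s) \<longrightarrow> J T = J T')"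

lemma births_uptoD:
  assumes "births_upto w J"
  shows "Measurable.pred TS J" "(\<And>C s. s \<le> w \<Longrightarrow> births T C s = births T' C s) \<Longrightarrow> J T = J T'"
  using assms unfolding births_upto_def by blast+

lemma nn_integral_indicator_Collect:
  assumes "Measurable.pred TS J"
  shows "(\<integral>\<^sup>+T. indicator {T. J T} T \<partial>TS) = emeasure TS {T \<in> space TS. J T}"
proof -
  have "(\<integral>\<^sup>+T. indicator {T. J T} T \<partial>TS) = (\<integral>\<^sup>+T. indicator {T \<in> space TS. J T} T \<partial>TS)"
    by (intro nn_integral_cong) (auto simp: indicator_def)
  also have "\<dots> = emeasure TS {T \<in> space TS. J T}"
    using assms by (intro nn_integral_indicator) measurable
  finally show ?thesis .
qed

lemma nn_integral_prod_first_factor: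
  assumes J: "births_upto w J" and "finite F" "0 \<notin> F"
  shows "(\<integral>\<^sup>+T. indicator {T. J T} T * (\<Prod>s\<in>F. first_factor c S C w t s T) \<partial>TS) =
    (\<integral>\<^sup>+T. indicator {T. J T} T \<partial>TS) * (\<Prod>s\<in>F. \<integral>\<^sup>+T. first_factor c S C w t s T \<partial>TS)"
  using assms(2,3)
proof (induction F rule: finite_induct)
  case (insert s F)
  have [measurable]: "Measurable.pred TS J" by (rule births_uptoD(1)[OF J])
  have [measurable]: "first_factor c S C w t r \<in> borel_measurable TS" if "r \<in> insert s F" for r
    using insert.prems that by (intro measurable_first_factor) (metis One_nat_def Suc_leI gr0I)
  \<comment> \<open>A birth count at \<open>s \<le> w\<close> must keep its value, since
    \<open>J\<close> may depend on it; the factor at such an \<open>s\<close> ignores it.\<close>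
  let ?KB = "\<lambda>_ :: stream_label. {s} \<inter> {w<..}" 
  let ?KC = "\<lambda>_ :: stream_label. {Newborn s 0} \<times> UNIV"
  have bin: "bin (mix ?KB ?KC T T') C s' t = (if s' = s then bin T' C s' t else bin T C s' t)" for T T' s'
    unfolding bin_def by (auto intro!: pos_cong)
  have "(\<integral>\<^sup>+T. indicator {T. J T} T * (\<Prod>s\<in>insert s F. first_factor c S C w t s T) \<partial>TS) =
    (\<integral>\<^sup>+T. (indicator {T. J T} T * (\<Prod>s\<in>F. first_factor c S C w t s T)) * first_factor c S C w t s T \<partial>TS)"
    using insert.hyps by (simp add: ac_simps)
  also have "\<dots> = (\<integral>\<^sup>+T. indicator {T. J T} T * (\<Prod>s\<in>F. first_factor c S C w t s T) \<partial>TS) *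
      (\<integral>\<^sup>+T. first_factor c S C w t s T \<partial>TS)"
  proof (rule nn_integral_mult_mix[where KB = ?KB and KC = ?KC])
    fix T T'
    have "J (mix ?KB ?KC T T') = J T"
      by (rule births_uptoD(2)[OF J]) simp
    moreover have "first_factor c S C w t s' (mix ?KB ?KC T T') = first_factor c S C w t s' T" if "s' \<in> F" for s'
    proof -
      have "s' \<noteq> s" using that insert.hyps by auto
      then show ?thesis by (simp add: first_factor_def bin)
    qed
    ultimately show "indicator {T. J T} (mix ?KB ?KC T T') * (\<Prod>s\<in>F. first_factor c S C w t s (mix ?KB ?KC T T')) =
        indicator {T. J T} T * (\<Prod>s\<in>F. first_factor c S C w t s T)"
      by (simp add: indicator_def)
    show "first_factor c S C w t s (mix ?KB ?KC T T') = first_factor c S C w t s T'"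
      unfolding first_factor_def bin mix_simps by auto
  qed measurable
  finally show ?case using insert by (simp add: ac_simps)
qed simp

text \<open>
  On \<open>J\<close> the balls born by step \<open>w\<close> are certain to exist, those born later exist
  independently of \<open>J\<close> with probability \<open>\<beta>\<close>.
\<close>
lemma small_weight_unlikely:
  assumes J: "births_upto w J"
    and ones: "\<And>T s. J T \<Longrightarrow> lo < s \<Longrightarrow> s \<le> w \<Longrightarrow> 1 \<le> births T C s"
    and S: "S \<subseteq> {1..m}" "\<And>j. j \<in> S \<Longrightarrow> p j \<le> c" "0 < c"
    and n: "2 * (\<Sum>i\<le>m. 1 / p i) \<le> real n" "n \<le> Suc (t - lo)"
  shows "emeasure TS {T \<in> space TS. J T \<and> weight (bin_weight S) T C lo t \<le> x} \<le>
    ennreal (exp (x / c - \<beta> * real (card S) / (4 * c))) * emeasure TS {T \<in> space TS. J T}"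
proof -
  have [measurable]: "Measurable.pred TS J" by (rule births_uptoD(1)[OF J])
  have fin: "finite S" using S(1) finite_subset by auto
  define g where "g s = (\<Sum>j\<in>S. p j * pos_prob (Suc t - s) j) / (2 * c)" for s
  \<comment> \<open>One factor 1/2 is the weight guaranteed per bin by
    \<open>sum_pos_prob_ge\<close>, the other comes from \<open>exp_minus_le\<close>.\<close>
  have "real (card S) / (4 * c) = (\<Sum>j\<in>S. 1 / 2) / (2 * c)" by simp
  also have "\<dots> \<le> (\<Sum>j\<in>S. p j * (\<Sum>a\<in>{1..t - lo}. pos_prob a j)) / (2 * c)"
    using S n by (intro divide_right_mono sum_mono sum_pos_prob_ge[of m n]) auto
  also have "(\<Sum>j\<in>S. p j * (\<Sum>a\<in>{1..t - lo}. pos_prob a j)) = (\<Sum>a\<in>{1..t - lo}. \<Sum>j\<in>S. p j * pos_prob a j)"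
    by (simp add: sum_distrib_left sum.swap[of _ S])
  also have "\<dots> = (\<Sum>s\<in>{lo<..t}. \<Sum>j\<in>S. p j * pos_prob (Suc t - s) j)"
    by (rule sum.reindex_bij_witness[of _ "\<lambda>s. Suc t - s" "\<lambda>a. Suc t - a"]) auto
  finally have g: "real (card S) / (4 * c) \<le> (\<Sum>s\<in>{lo<..t}. g s)"
    by (simp add: g_def sum_divide_distrib)
  have "emeasure TS {T \<in> space TS. J T \<and> weight (bin_weight S) T C lo t \<le> x} =
      (\<integral>\<^sup>+T. indicator {T \<in> space TS. J T \<and> weight (bin_weight S) T C lo t \<le> x} T \<partial>TS)"
    by (rule nn_integral_indicator[symmetric]) measurable
  \<comment> \<open>Chernoff's method with parameter \<open>1 / c\<close>, the largest for which all
    exponents of single balls stay within the range of \<open>exp_minus_le\<close>.\<close>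
  also have "\<dots> \<le> (\<integral>\<^sup>+T. ennreal (exp (x / c)) * (indicator {T. J T} T * (\<Prod>s\<in>{lo<..t}. first_factor c S C w t s T)) \<partial>TS)"
  proof (rule nn_integral_mono)
    fix T
    show "indicator {T \<in> space TS. J T \<and> weight (bin_weight S) T C lo t \<le> x} T \<le>
      ennreal (exp (x / c)) * (indicator {T. J T} T * (\<Prod>s\<in>{lo<..t}. first_factor c S C w t s T))"
    proof (cases "J T \<and> weight (bin_weight S) T C lo t \<le> x")
      case True
      have "(\<Prod>s\<in>{lo<..t}. first_factor c S C w t s T) = 
          (\<Prod>s\<in>{lo<..t}. ennreal (exp (- ((if s \<in> firsts T C lo t then bin_weight S (bin T C s t) else 0) / c))))"
        using True ones by (intro prod.cong) (auto simp: first_factor_def firsts_def)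
      also have "\<dots> = ennreal (exp (- (weight (bin_weight S) T C lo t / c)))"
        by (simp add: prod_ennreal exp_sum[symmetric] weight_def sum_firsts sum_negf sum_divide_distrib)
      finally have "ennreal (exp (x / c)) * (indicator {T. J T} T * (\<Prod>s\<in>{lo<..t}. first_factor c S C w t s T)) =
         ennreal (exp (x / c - weight (bin_weight S) T C lo t / c))"
        using True by (simp add: ennreal_mult[symmetric] exp_add[symmetric])
      moreover have "0 \<le> x / c - weight (bin_weight S) T C lo t / c"
        using True S(3) by (simp add: divide_right_mono)
      ultimately show ?thesis by (auto simp: indicator_def)
    qed auto
  qed
  also have "\<dots> = ennreal (exp (x / c)) * (\<integral>\<^sup>+T. indicator {T. J T} T * (\<Prod>s\<in>{lo<..t}. first_factor c S C w t s T) \<partial>TS)"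
  proof (rule nn_integral_cmult)
    have [measurable]: "first_factor c S C w t s \<in> borel_measurable TS" if "s \<in> {lo<..t}" for s
      using that by (intro measurable_first_factor) auto
    show "(\<lambda>T. indicator {T. J T} T * (\<Prod>s\<in>{lo<..t}. first_factor c S C w t s T)) \<in> borel_measurable TS"
      by measurable
  qed
  also have "\<dots> = ennreal (exp (x / c)) * ((\<integral>\<^sup>+T. indicator {T. J T} T \<partial>TS) * (\<Prod>s\<in>{lo<..t}. \<integral>\<^sup>+T. first_factor c S C w t s T \<partial>TS))"
    by (subst nn_integral_prod_first_factor[OF J]) auto
  also have "\<dots> \<le> ennreal (exp (x / c)) * ((\<integral>\<^sup>+T. indicator {T. J T} T \<partial>TS) *
      ennreal (exp (- (\<beta> * (real (card S) / (4 * c))))))"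
  proof (intro mult_left_mono)
    have "(\<Prod>s\<in>{lo<..t}. \<integral>\<^sup>+T. first_factor c S C w t s T \<partial>TS) \<le> (\<Prod>s\<in>{lo<..t}. ennreal (exp (- (\<beta> * g s))))"
      using S fin unfolding g_def
      by (intro prod_mono_ennreal nn_integral_first_factor) auto
    also have "\<dots> = ennreal (exp (- (\<beta> * (\<Sum>s\<in>{lo<..t}. g s))))"
      by (simp add: prod_ennreal exp_sum[symmetric] sum_negf sum_distrib_left)
    also have "\<dots> \<le> ennreal (exp (- (\<beta> * (real (card S) / (4 * c)))))"
      using mult_left_mono[OF g, of \<beta>] \<beta>_bounds by (intro ennreal_leI) simp
    finally show "(\<Prod>s\<in>{lo<..t}. \<integral>\<^sup>+T. first_factor c S C w t s T \<partial>TS) \<le>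
      ennreal (exp (- (\<beta> * (real (card S) / (4 * c)))))" .
  qed simp_all
  also have "(\<integral>\<^sup>+T. indicator {T. J T} T \<partial>TS) = emeasure TS {T \<in> space TS. J T}"
    by (rule nn_integral_indicator_Collect) measurable
  also have "ennreal (exp (x / c)) * (emeasure TS {T \<in> space TS. J T} * ennreal (exp (- (\<beta> * (real (card S) / (4 * c)))))) =
      ennreal (exp (x / c) * exp (- (\<beta> * (real (card S) / (4 * c))))) * emeasure TS {T \<in> space TS. J T}"
    by (simp add: ennreal_mult ac_simps)
  also have "exp (x / c) * exp (- (\<beta> * (real (card S) / (4 * c)))) = exp (x / c - \<beta> * real (card S) / (4 * c))"
    by (simp add: exp_add[symmetric])
  finally show ?thesis .
qed

end

section \<open>Unsticking many balls is unlikely\<close>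

context jammed
begin

lemma nn_integral_no_coins:
  assumes "finite F"
  shows "(\<integral>\<^sup>+T. (\<Prod>s\<in>F. indicator {T. \<not> coin T C (Newborn s 0, g s, u)} T) \<partial>TS) =
    (\<Prod>s\<in>F. ennreal (1 - p (g s)))"
  using assms
proof (induction F rule: finite_induct)
  case empty
  then show ?case by (simp add: TS.emeasure_space_1)
next
  case (insert s F)
  let ?I = "\<lambda>s T. indicator {T. \<not> coin T C (Newborn s 0, g s, u)} T :: ennreal"
  let ?KB = "\<lambda>_ :: stream_label. {} :: nat set" and ?KC = "\<lambda>_ :: stream_label. {(Newborn s 0, g s, u)}"
  have "(\<integral>\<^sup>+T. (\<Prod>s\<in>insert s F. ?I s T) \<partial>TS) = (\<integral>\<^sup>+T. (\<Prod>s\<in>F. ?I s T) * ?I s T \<partial>TS)"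
    using insert by (simp add: mult.commute)
  also have "\<dots> = (\<integral>\<^sup>+T. (\<Prod>s\<in>F. ?I s T) \<partial>TS) * (\<integral>\<^sup>+T. ?I s T \<partial>TS)"
  proof (rule nn_integral_mult_mix[where KB = ?KB and KC = ?KC])
    fix T T'
    have "?I s' (mix ?KB ?KC T T') = ?I s' T" if "s' \<in> F" for s'
      using that insert by (auto simp: indicator_def)
    then show "(\<Prod>s\<in>F. ?I s (mix ?KB ?KC T T')) = (\<Prod>s\<in>F. ?I s T)" by simp
    show "?I s (mix ?KB ?KC T T') = ?I s T'" by (simp add: indicator_def)
  qed measurable
  also have "(\<integral>\<^sup>+T. ?I s T \<partial>TS) = ennreal (1 - p (g s))"
    using nn_integral_coin[of "indicator {False}" C "Newborn s 0" "g s" u] by (simp add: indicator_def)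
  finally show ?case using insert by (simp add: mult.commute)
qed

abbreviation resample_step :: "stream_label \<Rightarrow> nat \<Rightarrow> two_stream \<Rightarrow> two_stream \<Rightarrow> two_stream" where
  "resample_step C u \<equiv> mix (\<lambda>_. {}) (\<lambda>D. if D = C then UNIV \<times> UNIV \<times> {u} else {})"

lemma agree_resample_step: "n < u \<Longrightarrow> agree_upto n (resample_step C u T T') T"
  by (auto simp: agree_upto_def)

text \<open>With the history up to \<open>t\<close> frozen, silence forces the fresh coin of every
  tracked stuck ball, in its current bin, to fail. These coins are independent, and
  \<open>1 - p \<le> exp (- p)\<close>.\<close>

lemma silent_unlikely:
  assumes "r \<le> stuck_weight (bin_weight S) T C lo t"
  shows "(\<integral>\<^sup>+T'. indicator {T. silent T C (Suc t)} (resample_step C (Suc t) T T') \<partial>TS) \<le> ennreal (exp (- r))"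
proof -
  define F where "F = {s \<in> firsts T C lo t. Newborn s 0 \<in> stuck_in T t C}"
  have fin: "finite F" by (simp add: F_def)
  have "(\<integral>\<^sup>+T'. indicator {T. silent T C (Suc t)} (resample_step C (Suc t) T T') \<partial>TS) \<le>
      (\<integral>\<^sup>+T'. (\<Prod>s\<in>F. indicator {T'. \<not> coin T' C (Newborn s 0, bin T C s t, Suc t)} T') \<partial>TS)"
  proof (rule nn_integral_mono)
    fix T'
    let ?T = "resample_step C (Suc t) T T'"
    note ag = agree_resample_step[of t "Suc t" C T T', simplified]
    have "\<not> coin T' C (Newborn s 0, bin T C s t, Suc t)" if "silent ?T C (Suc t)" "s \<in> F" for s
    proof -
      have "s \<in> firsts ?T C lo t" "Newborn s 0 \<in> stuck_in ?T t C"
        using that by (auto simp: F_def firsts_def agree_stuck_in[OF ag])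
      from silent_imp_no_coin[OF that(1) this] show ?thesis
        by (simp add: agree_bin[OF ag])
    qed
    then show "indicator {T. silent T C (Suc t)} ?T \<le>
        ((\<Prod>s\<in>F. indicator {T'. \<not> coin T' C (Newborn s 0, bin T C s t, Suc t)} T') :: ennreal)"
      by (auto simp: indicator_def intro!: prod_nonneg)
  qed
  also have "\<dots> = (\<Prod>s\<in>F. ennreal (1 - p (bin T C s t)))"
    by (rule nn_integral_no_coins[OF fin])
  also have "\<dots> \<le> (\<Prod>s\<in>F. ennreal (exp (- bin_weight S (bin T C s t))))"
  proof (intro prod_mono_ennreal ennreal_leI)
    fix s
    have "bin_weight S (bin T C s t) \<le> p (bin T C s t)"
      using p_bounds[of "bin T C s t"] by (simp add: bin_weight_def)
    then show "1 - p (bin T C s t) \<le> exp (- bin_weight S (bin T C s t))"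
      using exp_ge_add_one_self[of "- bin_weight S (bin T C s t)"] by linarith
  qed
  also have "\<dots> = ennreal (exp (- stuck_weight (bin_weight S) T C lo t))"
    unfolding stuck_weight_def F_def 
    by (simp add: prod_ennreal exp_sum[symmetric] sum_negf[symmetric] sum.inter_filter[symmetric])
  also have "\<dots> \<le> ennreal (exp (- r))" using assms by (intro ennreal_leI) simp
  finally show ?thesis .
qed

text \<open>
  The factors of a supermartingale in \<open>u\<close>, conditionally on everything but the coins of the other
  stream: the send weights of stream \<open>C\<close> are then constants.  \<open>S\<close> and \<open>l\<close> specify, for each
  step \<open>k\<close>, which part of the other stream is required to make noise.
\<close>
definition silence_factor ::
  "real \<Rightarrow> real \<Rightarrow> (nat \<Rightarrow> nat set) \<Rightarrow> (nat \<Rightarrow> nat) \<Rightarrow> (nat \<Rightarrow> real) \<Rightarrow> stream_label \<Rightarrow> nat \<Rightarrow> nat \<Rightarrow> nat \<Rightarrow> two_stream \<Rightarrow> real" where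
  "silence_factor c r S l W C lo t u T = send_weight c W T C lo t u / c *
     (of_bool (silent T (other C) u \<and>
        r \<le> stuck_weight (bin_weight (S (u - 1))) T (other C) (l (u - 1)) (u - 1)) - 2 * exp (- r))"

lemma measurable_silence_factor [measurable]:
  assumes "1 \<le> u"
  shows "(\<lambda>T. silence_factor c r S l W C lo t u T) \<in> borel_measurable TS"
proof -
  obtain v where u: "u = Suc v" using assms by (cases u) auto
  show ?thesis unfolding silence_factor_def u of_bool_def by measurable
qed

lemma other_neq [simp]: "other C \<noteq> C" "C \<noteq> other C"
  by (cases C; simp)+

lemma send_weight_resample [simp]:
  "send_weight c W (resample_step (other C) v T T') C lo t u = send_weight c W T C lo t u"
proof -
  have "bin (resample_step (other C) v T T') C s k = bin T C s k" for s k
    unfolding bin_def by (intro pos_cong) auto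
  then show ?thesis by (simp add: send_weight_def firsts_def first_sends_def cong: if_cong)
qed

lemma silence_factor_agree:
  assumes "u < v"
  shows "silence_factor c r S l W C lo t u (resample_step (other C) v T T') = silence_factor c r S l W C lo t u T"
proof -
  note ag = agree_resample_step[OF assms, of "other C" T T']
  show ?thesis
    by (simp add: silence_factor_def agree_silent[OF ag] agree_stuck_weight[OF ag])
qed

text \<open>Here the compensator \<open>2 * exp (- r)\<close> originates. The cap in
  \<open>send_weight\<close> gives \<open>0 \<le> x \<le> 1\<close>, so
  \<open>exp x \<le> 1 + 2 * x\<close>; with silence of probability at most
  \<open>\<delta> = exp (- r)\<close> the moment is at most
  \<open>exp (- (2 * \<delta> * x)) * (1 + 2 * \<delta> * x) \<le> 1\<close>.\<close>

lemma nn_integral_silence_factor_le: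
  assumes W: "\<And>j. 0 \<le> W j" "0 < c" and T: "T \<in> space TS"
  shows "(\<integral>\<^sup>+T'. ennreal (exp (silence_factor c r S l W C lo t (Suc n) (resample_step (other C) (Suc n) T T'))) \<partial>TS) \<le> 1"
proof -
  note ag = agree_resample_step[of n "Suc n" "other C" T, simplified]
  define x where "x = send_weight c W T C lo t (Suc n) / c"
  have x: "0 \<le> x" "x \<le> 1"
    using send_weight_bounds[where W = W and a = c, of T C lo t "Suc n"] W by (auto simp: x_def)
  define \<delta> where "\<delta> = exp (- r)"
  have \<delta>: "0 \<le> \<delta>" by (simp add: \<delta>_def)
  have sf: "silence_factor c r S l W C lo t (Suc n) (resample_step (other C) (Suc n) T T') =
    x * (of_bool (silent (resample_step (other C) (Suc n) T T') (other C) (Suc n) \<and>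
        r \<le> stuck_weight (bin_weight (S n)) T (other C) (l n) n) - 2 * \<delta>)" for T'
    by (simp add: silence_factor_def x_def \<delta>_def agree_stuck_weight[OF ag])
  show ?thesis
  proof (cases "r \<le> stuck_weight (bin_weight (S n)) T (other C) (l n) n")
    case False
    have "(\<integral>\<^sup>+T'. ennreal (exp (silence_factor c r S l W C lo t (Suc n) (resample_step (other C) (Suc n) T T'))) \<partial>TS)
       \<le> (\<integral>\<^sup>+T'. 1 \<partial>TS)"
      using False x \<delta> by (intro nn_integral_mono) (simp add: sf ennreal_le_1)
    then show ?thesis by (simp add: TS.emeasure_space_1)
  next
    case True
    let ?q = "\<integral>\<^sup>+T'. indicator {T. silent T (other C) (Suc n)} (resample_step (other C) (Suc n) T T') \<partial>TS"
    have [measurable]: "(\<lambda>T'. indicator {T. silent T (other C) (Suc n)} (resample_step (other C) (Suc n) T T') :: ennreal) \<in> borel_measurable TS"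
      using T by measurable
    have ex: "exp x \<le> 1 + 2 * x"
    proof -
      have "exp x \<le> 1 + x + x\<^sup>2" using x by (intro exp_bound) auto
      moreover have "x\<^sup>2 \<le> x" using x by (simp add: power2_eq_square mult_left_le)
      ultimately show ?thesis by simp
    qed
    show ?thesis
    proof -
      have "(\<integral>\<^sup>+T'. ennreal (exp (silence_factor c r S l W C lo t (Suc n) (resample_step (other C) (Suc n) T T'))) \<partial>TS)
         \<le> (\<integral>\<^sup>+T'. ennreal (exp (- (2 * \<delta> * x))) + ennreal (exp (- (2 * \<delta> * x)) * (2 * x)) *
              indicator {T. silent T (other C) (Suc n)} (resample_step (other C) (Suc n) T T') \<partial>TS)"
      proof (rule nn_integral_mono)
        fix T'
        have "exp (x * (1 - 2 * \<delta>)) = exp (- (2 * \<delta> * x)) * exp x"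
          by (simp add: exp_add[symmetric] algebra_simps)
        also have "\<dots> \<le> exp (- (2 * \<delta> * x)) * (1 + 2 * x)" using ex by (intro mult_left_mono) auto
        finally have "exp (x * (1 - 2 * \<delta>)) \<le> exp (- (2 * \<delta> * x)) + exp (- (2 * \<delta> * x)) * (2 * x)"
          by (simp add: algebra_simps)
        then show "ennreal (exp (silence_factor c r S l W C lo t (Suc n) (resample_step (other C) (Suc n) T T'))) \<le>
           ennreal (exp (- (2 * \<delta> * x))) + ennreal (exp (- (2 * \<delta> * x)) * (2 * x)) *
              indicator {T. silent T (other C) (Suc n)} (resample_step (other C) (Suc n) T T')"
          using True x unfolding sf
          by (auto simp: indicator_def ennreal_plus[symmetric] algebra_simps simp del: ennreal_plus intro!: ennreal_leI)
      qed
      also have "\<dots> = ennreal (exp (- (2 * \<delta> * x))) + ennreal (exp (- (2 * \<delta> * x)) * (2 * x)) * ?q"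
        by (subst nn_integral_add) (simp_all add: nn_integral_cmult TS.emeasure_space_1)
      also have "\<dots> \<le> ennreal (exp (- (2 * \<delta> * x))) + ennreal (exp (- (2 * \<delta> * x)) * (2 * x)) * ennreal \<delta>"
        unfolding \<delta>_def by (intro add_left_mono mult_left_mono silent_unlikely[OF True]) auto
      also have "\<dots> = ennreal (exp (- (2 * \<delta> * x)) * (1 + 2 * \<delta> * x))"
        using x \<delta> by (simp add: ennreal_mult[symmetric] ennreal_plus[symmetric] algebra_simps del: ennreal_plus)
      also have "\<dots> \<le> ennreal (exp (- (2 * \<delta> * x)) * exp (2 * \<delta> * x))"
        using exp_ge_add_one_self[of "2 * \<delta> * x"] by (intro ennreal_leI mult_left_mono) auto
      also have "\<dots> = 1" by (simp add: exp_add[symmetric])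
      finally show ?thesis .
    qed
  qed
qed

text \<open>In each induction step only the coins of the other stream at step \<open>Suc n\<close>
  are refreshed; \<open>J\<close>, the earlier factors and the send weights of \<open>C\<close> do
  not read them.\<close>

lemma supermartingale:
  assumes W: "\<And>j. 0 \<le> W j" "0 < c" and J: "births_upto w J" and "lo \<le> n"
  shows "(\<integral>\<^sup>+T. indicator {T. J T} T * (\<Prod>u\<in>{lo<..n}. ennreal (exp (silence_factor c r S l W C lo t u T))) \<partial>TS) \<le>
    (\<integral>\<^sup>+T. indicator {T. J T} T \<partial>TS)"
  using assms(4)
proof (induction n rule: dec_induct)
  case (step n)
  have [measurable]: "Measurable.pred TS J" by (rule births_uptoD(1)[OF J])
  let ?f = "\<lambda>u T. ennreal (exp (silence_factor c r S l W C lo t u T))"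
  have [measurable]: "?f u \<in> borel_measurable TS" if "lo < u" for u
    using that measurable_silence_factor[of u] by simp
  have *: "{lo<..Suc n} = insert (Suc n) {lo<..n}" using step by auto
  let ?P = "\<lambda>T. indicator {T. J T} T * (\<Prod>u\<in>{lo<..n}. ?f u T)"
  have P [measurable]: "?P \<in> borel_measurable TS" by measurable
  have f [measurable]: "?f (Suc n) \<in> borel_measurable TS" using step by measurable
  have "(\<integral>\<^sup>+T. indicator {T. J T} T * (\<Prod>u\<in>{lo<..Suc n}. ?f u T) \<partial>TS) =
     (\<integral>\<^sup>+T. ?P T * ?f (Suc n) T \<partial>TS)"
    by (simp add: * ac_simps)
  also have "\<dots> = (\<integral>\<^sup>+T. \<integral>\<^sup>+T'. ?P T * ?f (Suc n) (resample_step (other C) (Suc n) T T') \<partial>TS \<partial>TS)"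
  proof (subst nn_integral_mix[where KB = "\<lambda>_. {}" and KC = "\<lambda>D. if D = other C then UNIV \<times> UNIV \<times> {Suc n} else {}"])
    have "J (resample_step (other C) (Suc n) T T') = J T" for T T'
      by (rule births_uptoD(2)[OF J]) simp
    moreover have "(\<Prod>u\<in>{lo<..n}. ?f u (resample_step (other C) (Suc n) T T')) = (\<Prod>u\<in>{lo<..n}. ?f u T)" for T T'
      by (intro prod.cong refl) (simp add: silence_factor_agree)
    ultimately show "(\<integral>\<^sup>+T. \<integral>\<^sup>+T'. ?P (resample_step (other C) (Suc n) T T') * ?f (Suc n) (resample_step (other C) (Suc n) T T') \<partial>TS \<partial>TS) = 
      (\<integral>\<^sup>+T. \<integral>\<^sup>+T'. ?P T * ?f (Suc n) (resample_step (other C) (Suc n) T T') \<partial>TS \<partial>TS)"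
      by (simp add: indicator_def)
  qed measurable
  also have "\<dots> = (\<integral>\<^sup>+T. ?P T * (\<integral>\<^sup>+T'. ?f (Suc n) (resample_step (other C) (Suc n) T T') \<partial>TS) \<partial>TS)"
    by (intro nn_integral_cong nn_integral_cmult) measurable
  also have "\<dots> \<le> (\<integral>\<^sup>+T. ?P T * 1 \<partial>TS)"
    by (intro nn_integral_mono mult_left_mono nn_integral_silence_factor_le W) auto
  finally show ?case using step by simp
qed simp

text \<open>Let \<open>X\<close> be the weight. If at least half of it became unstuck, the silent
  steps carry send weight at least \<open>X / 2\<close>, while the compensator is at most
  \<open>2 * exp (- r) * m * X \<le> X / 4\<close>. So the exponent of the supermartingale is at
  least \<open>X / (4 * c)\<close>, and Markov's inequality applies.\<close>

lemma unsticking_unlikely: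
  assumes J: "births_upto w J"
    and ones: "\<And>T s D. J T \<Longrightarrow> lo < s \<Longrightarrow> s \<le> w \<Longrightarrow> 1 \<le> births T D s"
    and S0: "S0 \<subseteq> {1..m}" "\<And>j. j \<in> S0 \<Longrightarrow> p j \<le> c" "0 < c"
    and \<delta>: "exp (- r) * real m \<le> 1 / 8" and x: "0 \<le> x"
    and t: "lo \<le> t"
  shows "emeasure TS {T \<in> space TS. J T \<and> x \<le> weight (bin_weight S0) T C lo t \<and>
      stuck_weight (bin_weight S0) T C lo t \<le> weight (bin_weight S0) T C lo t / 2 \<and>
      (\<forall>k. w \<le> k \<and> lo \<le> k \<and> k < t \<longrightarrow> r \<le> stuck_weight (bin_weight (S k)) T (other C) (l k) k)}
    \<le> ennreal (exp (- (x / (4 * c)))) * emeasure TS {T \<in> space TS. J T}" (is "emeasure TS ?E \<le> _")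
proof -
  have [measurable]: "Measurable.pred TS J" by (rule births_uptoD(1)[OF J])
  let ?W = "bin_weight S0"
  let ?f = "\<lambda>u T. silence_factor c r S l ?W C lo t u T"
  have W: "0 \<le> ?W j" "?W j \<le> c" "m < j \<Longrightarrow> ?W j = 0" for j
    using S0 p_bounds[of j] by (auto simp: bin_weight_def less_imp_le)
  have [measurable]: "?f u \<in> borel_measurable TS" if "lo < u" for u
    using that measurable_silence_factor[of u] by simp
  let ?Q = "{T \<in> space TS. J T \<and> x / (4 * c) \<le> (\<Sum>u\<in>{lo<..t}. ?f u T)}"
  have E0 [measurable]: "?Q \<in> sets TS" by measurable
  have "emeasure TS ?E \<le> emeasure TS ?Q"
  proof (rule emeasure_mono_AE[OF _ E0])
    show "AE T in TS. T \<in> ?E \<longrightarrow> T \<in> ?Q"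
      using AE_choice_ok AE_bin0_sends
    proof eventually_elim
      case (elim T)
      show ?case
      proof
        assume E: "T \<in> ?E"
        let ?X = "weight ?W T C lo t" and ?w = "\<lambda>u. send_weight c ?W T C lo t u"
        let ?s = "\<lambda>u. silent T (other C) u \<and> r \<le> stuck_weight (bin_weight (S (u - 1))) T (other C) (l (u - 1)) (u - 1)"
        \<comment> \<open>Up to step \<open>w\<close> births in the other stream exclude silence;
          afterwards the noise requirement is part of the event. Hence adding it to silence changes
          nothing.\<close>
        have s: "silent T (other C) u \<longleftrightarrow> ?s u" if u: "u \<in> {lo<..t}" for u
        proof (cases "u \<le> w")
          case True
          then have "\<not> silent T (other C) u"
            using u E elim ones[of T u "other C"] by (intro not_silent_if_births) auto
          then show ?thesis by simp
        next
          case False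
          then have "w \<le> u - 1 \<and> lo \<le> u - 1 \<and> u - 1 < t" using u by auto
          then show ?thesis using E by blast
        qed
        have "?X \<le> stuck_weight ?W T C lo t + (\<Sum>u\<in>{lo<..t}. if silent T (other C) u then ?w u else 0)"
          using elim W by (intro weight_le_stuck_weight) auto
        also have "(\<Sum>u\<in>{lo<..t}. if silent T (other C) u then ?w u else 0) = (\<Sum>u\<in>{lo<..t}. ?w u * of_bool (?s u))"
          using s by (intro sum.cong) auto
        finally have 1: "?X / 2 \<le> (\<Sum>u\<in>{lo<..t}. ?w u * of_bool (?s u))" using E by simp
        have "0 \<le> ?X" using W by (auto simp: weight_def intro!: sum_nonneg)
        have "2 * exp (- r) * (\<Sum>u\<in>{lo<..t}. ?w u) \<le> 2 * exp (- r) * (real m * ?X)"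
          using W by (intro mult_left_mono sum_send_weight_le) auto
        also have "\<dots> = 2 * (exp (- r) * real m) * ?X" by simp
        also have "\<dots> \<le> 2 * (1 / 8) * ?X" using \<delta> \<open>0 \<le> ?X\<close> by (intro mult_right_mono mult_left_mono) auto
        finally have 2: "2 * exp (- r) * (\<Sum>u\<in>{lo<..t}. ?w u) \<le> ?X / 4" by simp
        have "(\<Sum>u\<in>{lo<..t}. ?f u T) = (\<Sum>u\<in>{lo<..t}. (?w u * of_bool (?s u) - 2 * exp (- r) * ?w u) / c)"
          by (intro sum.cong) (auto simp: silence_factor_def algebra_simps diff_divide_distrib)
        also have "\<dots> = ((\<Sum>u\<in>{lo<..t}. ?w u * of_bool (?s u)) - 2 * exp (- r) * (\<Sum>u\<in>{lo<..t}. ?w u)) / c"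
          by (simp only: sum_divide_distrib[symmetric] sum_subtractf sum_distrib_left)
        also have "\<dots> \<ge> (x / 4) / c"
          using 1 2 E S0(3) by (intro divide_right_mono) auto
        finally show "T \<in> ?Q" using E by simp
      qed
    qed
  qed
  also have "emeasure TS ?Q = (\<integral>\<^sup>+T. indicator ?Q T \<partial>TS)"
    by (rule nn_integral_indicator[symmetric]) measurable
  also have "\<dots> \<le> (\<integral>\<^sup>+T. ennreal (exp (- (x / (4 * c)))) * (indicator {T. J T} T * (\<Prod>u\<in>{lo<..t}. ennreal (exp (?f u T)))) \<partial>TS)"
  proof (rule nn_integral_mono)
    fix T
    show "indicator ?Q T \<le> ennreal (exp (- (x / (4 * c)))) * (indicator {T. J T} T * (\<Prod>u\<in>{lo<..t}. ennreal (exp (?f u T))))"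
    proof (cases "T \<in> ?Q")
      case True
      then have "1 \<le> ennreal (exp (- (x / (4 * c)) + (\<Sum>u\<in>{lo<..t}. ?f u T)))" by simp
      also have "\<dots> = ennreal (exp (- (x / (4 * c)))) * (\<Prod>u\<in>{lo<..t}. ennreal (exp (?f u T)))"
        by (simp add: prod_ennreal exp_sum[symmetric] exp_add[symmetric] ennreal_mult[symmetric])
      finally show ?thesis using True by simp
    qed simp
  qed
  also have "\<dots> = ennreal (exp (- (x / (4 * c)))) * (\<integral>\<^sup>+T. indicator {T. J T} T * (\<Prod>u\<in>{lo<..t}. ennreal (exp (?f u T))) \<partial>TS)"
    by (rule nn_integral_cmult) measurable
  also have "\<dots> \<le> ennreal (exp (- (x / (4 * c)))) * (\<integral>\<^sup>+T. indicator {T. J T} T \<partial>TS)"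
    using W S0(3) t by (intro mult_left_mono supermartingale[OF _ _ J]) auto
  also have "(\<integral>\<^sup>+T. indicator {T. J T} T \<partial>TS) = emeasure TS {T \<in> space TS. J T}"
    by (rule nn_integral_indicator_Collect) measurable
  finally show ?thesis .
qed

end

section \<open>Suitable send sequences\<close>

locale suitable_jammed = jammed +
  fixes \<eta> \<nu> :: real
  assumes lam1: "lam < 1"
    and \<eta>: "0 < \<eta>" "\<eta> < 1"
    and \<nu>: "0 < \<nu>" "\<nu> < 1"
    and suitable: "suitable lam \<eta> \<nu> p"
begin

definition rate :: real where
  "rate = ln (1 / \<nu>)"

abbreviation threshold :: real where
  "threshold \<equiv> p_star lam \<eta> \<nu>"

text \<open>
  At age \<open>n\<close>, that is \<open>n\<close> steps after the start of an attempt, only the slow bins up to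
  \<open>depth n\<close> are watched: by then they are filled, as for large \<open>j \<le> depth n\<close> the mean stay
  \<open>1 / p j\<close> is below \<open>(1 / \<nu>) ^ j\<close>, which is at most the cube root of \<open>n\<close>.
\<close>
definition depth :: "nat \<Rightarrow> nat" where
  "depth n = nat \<lfloor>ln (real n) / (3 * rate)\<rfloor>"

definition slow :: "nat \<Rightarrow> nat set" where
  "slow n = {j \<in> {1..depth n}. p j \<le> threshold}"

text \<open>A quarter of the mean weight that can be guaranteed: each slow bin contributes at least
  \<open>\<beta> / 2\<close>, and for large \<open>n\<close> there are at least
  \<open>\<eta> * depth n\<close> of them.\<close>

definition level :: "nat \<Rightarrow> real" where
  "level n = \<beta> * \<eta> * real (depth n) / 8"

lemma rate_pos: "0 < rate"
  using \<nu> by (simp add: rate_def)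

lemma depth_le: "1 \<le> n \<Longrightarrow> real (depth n) \<le> ln (real n) / (3 * rate)"
  using rate_pos by (simp add: depth_def)

lemma depth_ge: "ln (real n) / (3 * rate) - 1 \<le> real (depth n)"
  unfolding depth_def by linarith

lemma depth_mono: "1 \<le> n \<Longrightarrow> n \<le> n' \<Longrightarrow> depth n \<le> depth n'"
  unfolding depth_def using rate_pos by (intro nat_mono floor_mono divide_right_mono) auto

lemma filterlim_depth: "filterlim depth at_top at_top"
proof -
  have "filterlim (\<lambda>n. ln (real n) / (3 * rate) - 1) at_top at_top"
    using rate_pos by real_asymp
  then have "filterlim (\<lambda>n. real (depth n)) at_top at_top"
    by (rule filterlim_at_top_mono) (simp add: depth_ge)
  then show ?thesis by (simp add: filterlim_sequentially_iff_filterlim_real)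
qed

lemma kappa_bound: "9 \<le> (real_of_int (kappa \<eta>))\<^sup>2"
proof -
  have "3 \<le> 3 / \<eta>" using \<eta> by (simp add: field_simps)
  also have "\<dots> \<le> real_of_int (kappa \<eta>)" by (simp add: kappa_def)
  finally have "3\<^sup>2 \<le> (real_of_int (kappa \<eta>))\<^sup>2" by (intro power_mono) auto
  then show ?thesis by simp
qed

lemma threshold_pos: "0 < threshold"
  using lam_pos \<eta> kappa_bound rate_pos unfolding p_star_def rate_def
  by (auto intro!: divide_pos_pos mult_pos_pos)

text \<open>The threshold is bounded by a multiple of \<open>lam\<close>, so a bound for
  \<open>\<beta>\<close> linear in \<open>lam\<close> is required. With
  \<open>x = lam / 2 \<le> 1 / 2\<close> it follows from
  \<open>exp x \<ge> 1 + x + x * x / 2\<close>.\<close>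

lemma \<beta>_ge: "3 / 8 * lam \<le> \<beta>"
proof -
  define x where "x = lam / 2"
  have x: "0 \<le> x" "x \<le> 1 / 2" using lam_pos lam1 by (auto simp: x_def)
  have "exp (- x) * (1 + x + x\<^sup>2 / 2) \<le> exp (- x) * exp x"
    using x by (intro mult_left_mono exp_lower_Taylor_quadratic) auto
  then have 1: "exp (- x) * (1 + x + x\<^sup>2 / 2) \<le> 1" by (simp add: exp_add[symmetric])
  have 2: "x * x \<le> x / 2" using x mult_left_mono[of x "1/2" x] by simp
  have "x * (x * x) \<le> x * (x / 2)" using x 2 by (intro mult_left_mono) auto
  moreover have "(1 - 3 / 4 * x) * (1 + x + x\<^sup>2 / 2) = 1 + (x / 4 - x * x / 4 - 3 / 8 * (x * (x * x)))"
    by (simp add: field_simps power2_eq_square)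
  ultimately have "1 \<le> (1 - 3 / 4 * x) * (1 + x + x\<^sup>2 / 2)"
    using 2 x by simp
  then have "exp (- x) * (1 + x + x\<^sup>2 / 2) \<le> (1 - 3 / 4 * x) * (1 + x + x\<^sup>2 / 2)" using 1 by linarith
  moreover have "0 < 1 + x + x\<^sup>2 / 2" using x by (intro add_pos_nonneg) auto
  ultimately have "exp (- x) \<le> 1 - 3 / 4 * x" by (simp only: mult_le_cancel_right_pos)
  then show ?thesis by (simp add: \<beta>_def x_def)
qed

text \<open>Since \<open>kappa \<eta> \<ge> 3\<close>, the constant 1800 becomes 16200, and 16200 *
  (3/8) / 32 is slightly above 189. In the proof, 6048 is 189 * 32.\<close>

lemma threshold_rate: "189 * rate \<le> \<beta> * \<eta> / (32 * threshold)"
proof -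
  let ?k = "(real_of_int (kappa \<eta>))\<^sup>2"
  have "threshold \<le> lam * \<eta> / (1800 * ?k * rate)"
    by (simp add: p_star_def rate_def)
  also have "\<dots> \<le> lam * \<eta> / (1800 * 9 * rate)"
    using lam_pos \<eta> rate_pos kappa_bound by (intro divide_left_mono mult_right_mono mult_left_mono mult_pos_pos) auto
  finally have "threshold * (16200 * rate) \<le> lam * \<eta>"
    using rate_pos by (simp add: field_simps)
  then have "6048 / 16200 * (threshold * (16200 * rate)) \<le> 6048 / 16200 * (lam * \<eta>)"
    by (intro mult_left_mono) auto
  then have "189 * rate * (32 * threshold) \<le> 6048 / 16200 * (lam * \<eta>)" by (simp add: ac_simps)
  also have "\<dots> \<le> 3 / 8 * (lam * \<eta>)" using lam_pos \<eta> by (intro mult_right_mono) auto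
  also have "\<dots> \<le> \<beta> * \<eta>" using \<beta>_ge \<eta> mult_right_mono[of "3 / 8 * lam" \<beta> \<eta>] by simp
  finally show ?thesis using threshold_pos by (simp add: pos_le_divide_eq)
qed

section \<open>Estimates valid for all large ages\<close>

lemma eventually_slow: "eventually (\<lambda>n. \<eta> * real (depth n) \<le> real (card (slow n))) at_top"
proof -
  obtain n0 where n0: "\<forall>n\<ge>n0. real (card {j \<in> {1..n}. p j \<le> threshold}) > \<eta> * real n"
    using suitable by (auto simp: suitable_def)
  have "eventually (\<lambda>n. n0 \<le> depth n) at_top"
    using filterlim_depth by (simp add: filterlim_at_top)
  then show ?thesis
    by eventually_elim (use n0 in \<open>auto simp: slow_def intro: less_imp_le\<close>)
qed

text \<open>Finitely many early bins cost a constant \<open>K\<close>; the others cost at most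
  \<open>exp (rate * depth n)\<close> each, which is at most the cube root of \<open>n\<close>. The
  total is of smaller order than \<open>n\<close>.\<close>

lemma eventually_filled: "eventually (\<lambda>n. 2 * (\<Sum>i\<le>depth n. 1 / p i) \<le> real (n - n div 2)) at_top"
proof -
  obtain n0 where n0: "\<And>i. n0 \<le> i \<Longrightarrow> \<nu> ^ i < p i"
    using suitable by (auto simp: suitable_def)
  define K where "K = (\<Sum>i<n0. 1 / p i)"
  have bound: "(\<Sum>i\<le>m. 1 / p i) \<le> K + (real m + 1) * exp (rate * real m)" for m
  proof -
    have "1 / p i \<le> (if i < n0 then 1 / p i else 0) + exp (rate * real m)" if "i \<le> m" for i
    proof (cases "i < n0")
      case False
      then have "1 / p i \<le> 1 / \<nu> ^ i" using n0[of i] \<nu> by (intro divide_left_mono) (auto intro!: mult_pos_pos p_bounds)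
      also have "\<dots> = exp (rate * real i)"
        using \<nu> by (simp add: rate_def ln_div exp_minus exp_of_nat2_mult power_one_over[symmetric] inverse_eq_divide)
      also have "\<dots> \<le> exp (rate * real m)" using that rate_pos by simp
      finally show ?thesis using False by simp
    qed simp
    then have "(\<Sum>i\<le>m. 1 / p i) \<le> (\<Sum>i\<le>m. (if i < n0 then 1 / p i else 0) + exp (rate * real m))"
      by (intro sum_mono) auto
    also have "\<dots> = (\<Sum>i\<le>m. if i < n0 then 1 / p i else 0) + (real m + 1) * exp (rate * real m)"
      by (simp add: sum.distrib)
    also have "(\<Sum>i\<le>m. if i < n0 then 1 / p i else 0) = (\<Sum>i\<in>{i \<in> {..m}. i < n0}. 1 / p i)"
      by (rule sum.inter_filter[symmetric]) simp
    also have "\<dots> \<le> K"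
      unfolding K_def using p_bounds by (intro sum_mono2) (auto simp: less_imp_le)
    finally show ?thesis by simp
  qed
  have "eventually (\<lambda>n. 2 * (K + (ln (real n) / (3 * rate) + 1) * exp (ln (real n) / 3)) \<le> real n / 2) at_top"
    using rate_pos by real_asymp
  then show ?thesis using eventually_ge_at_top[of 1]
  proof eventually_elim
    case (elim n)
    have "(\<Sum>i\<le>depth n. 1 / p i) \<le> K + (real (depth n) + 1) * exp (rate * real (depth n))" by (rule bound)
    also have "\<dots> \<le> K + (ln (real n) / (3 * rate) + 1) * exp (ln (real n) / 3)"
    proof (intro add_left_mono mult_mono add_right_mono depth_le elim)
      have "rate * real (depth n) \<le> rate * (ln (real n) / (3 * rate))"
        using rate_pos elim by (intro mult_left_mono depth_le) auto
      then show "exp (rate * real (depth n)) \<le> exp (ln (real n) / 3)" using rate_pos by simp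
    qed (use elim rate_pos in auto)
    finally have "2 * (\<Sum>i\<le>depth n. 1 / p i) \<le> 2 * (K + (ln (real n) / (3 * rate) + 1) * exp (ln (real n) / 3))"
      by (intro mult_left_mono) auto
    also have "\<dots> \<le> real n / 2" by (rule elim)
    also have "\<dots> \<le> real (n - n div 2)" by linarith
    finally show ?case .
  qed
qed

text \<open>The level at half the age grows like a multiple of \<open>log n\<close>, so the
  exponential is bounded by a negative power of \<open>n\<close>, which beats the logarithmic
  \<open>depth n\<close>.\<close>

lemma eventually_quiet_rare:
  "eventually (\<lambda>n. exp (- (level (n div 2) / 2)) * real (depth n) \<le> 1 / 8) at_top"
proof -
  define \<gamma> where "\<gamma> = \<beta> * \<eta> / 16"
  have \<gamma>: "0 < \<gamma>" using \<beta>_bounds \<eta> by (simp add: \<gamma>_def)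
  \<comment> \<open>The term \<open>n / 3\<close> is a lower bound for \<open>n div 2\<close>
    without rounding, suited to \<open>real_asymp\<close>.\<close>
  have "eventually (\<lambda>n. exp (- (\<gamma> * (ln (real n / 3) / (3 * rate) - 1))) * (ln (real n) / (3 * rate)) \<le> 1 / 8) at_top"
    using rate_pos \<gamma> by real_asymp
  then show ?thesis using eventually_ge_at_top[of 3]
  proof eventually_elim
    case (elim n)
    have "ln (real n / 3) \<le> ln (real (n div 2))" using elim(2) by (intro ln_mono) linarith+
    then have "ln (real n / 3) / (3 * rate) - 1 \<le> ln (real (n div 2)) / (3 * rate) - 1"
      using rate_pos by (intro diff_right_mono divide_right_mono) auto
    also have "\<dots> \<le> real (depth (n div 2))" by (rule depth_ge)
    finally have "\<gamma> * (ln (real n / 3) / (3 * rate) - 1) \<le> \<gamma> * real (depth (n div 2))"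
      using \<gamma> by (intro mult_left_mono) auto
    also have "\<dots> = level (n div 2) / 2" by (simp add: level_def \<gamma>_def)
    finally have "exp (- (level (n div 2) / 2)) * real (depth n) \<le>
       exp (- (\<gamma> * (ln (real n / 3) / (3 * rate) - 1))) * (ln (real n) / (3 * rate))"
      using elim by (intro mult_mono depth_le) auto
    with elim show ?case by linarith
  qed
qed

text \<open>By \<open>threshold_rate\<close> the exponent is asymptotically at least
  \<open>63 * ln n\<close>, far above the \<open>2 * ln n\<close> that makes the failure
  probabilities summable.\<close>

lemma eventually_level:
  "eventually (\<lambda>n. exp (- (level n / (4 * threshold))) \<le> 1 / (real n)\<^sup>2 \<and> 0 < level n) at_top"
proof -
  have "eventually (\<lambda>n. 2 * ln (real n) \<le> 189 * rate * (ln (real n) / (3 * rate) - 1)) at_top"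
    using rate_pos by real_asymp
  moreover have "eventually (\<lambda>n. 1 \<le> depth n) at_top"
    using filterlim_depth by (simp add: filterlim_at_top)
  ultimately show ?thesis using eventually_ge_at_top[of 1]
  proof eventually_elim
    case (elim n)
    have "2 * ln (real n) \<le> 189 * rate * (ln (real n) / (3 * rate) - 1)" by (rule elim)
    also have "\<dots> \<le> 189 * rate * real (depth n)" using rate_pos depth_ge by (intro mult_left_mono) auto
    also have "\<dots> \<le> \<beta> * \<eta> / (32 * threshold) * real (depth n)" by (intro mult_right_mono threshold_rate) simp
    also have "\<dots> = level n / (4 * threshold)" by (simp add: level_def)
    finally have "exp (- (level n / (4 * threshold))) \<le> exp (- (2 * ln (real n)))" by simp
    also have "\<dots> = 1 / (real n)\<^sup>2"
      using elim by (simp add: exp_minus exp_double inverse_eq_divide)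
    finally show ?case using elim \<beta>_bounds \<eta> by (auto simp: level_def)
  qed
qed

definition large :: "nat \<Rightarrow> bool" where
  "large n \<longleftrightarrow> 2 \<le> n \<and> \<eta> * real (depth n) \<le> real (card (slow n)) \<and>
     2 * (\<Sum>i\<le>depth n. 1 / p i) \<le> real (n - n div 2) \<and>
     exp (- (level (n div 2) / 2)) * real (depth n) \<le> 1 / 8 \<and>
     exp (- (level n / (4 * threshold))) \<le> 1 / (real n)\<^sup>2 \<and> 0 < level n"

lemma eventually_large: "eventually large at_top"
  using eventually_ge_at_top[of 2] eventually_slow eventually_filled eventually_quiet_rare eventually_level
  unfolding large_def by eventually_elim auto

text \<open>Only balls born after age \<open>n div 2\<close> count: while they are present, the
  level required of the other stream is at least \<open>level (n div 2)\<close>, and the remaining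
  \<open>n - n div 2\<close> steps still suffice to fill the bins.\<close>

definition noisy :: "nat \<Rightarrow> two_stream \<Rightarrow> stream_label \<Rightarrow> nat \<Rightarrow> bool" where
  "noisy t0 T C n \<longleftrightarrow>
     level n / 2 \<le> stuck_weight (bin_weight (slow n)) T C (t0 + n div 2) (t0 + n)"

lemma measurable_noisy [measurable]: "Measurable.pred TS (\<lambda>T. noisy t0 T C n)"
  unfolding noisy_def by measurable

text \<open>Either the watched weight is at most \<open>level n\<close> (the event
  \<open>?A\<close>), or it is larger and less than half of it is still stuck, a case covered by
  \<open>?B\<close>. Each alternative costs \<open>1 / n^2\<close>.\<close>

lemma first_failure_unlikely:
  assumes J: "births_upto (t0 + L) J"
    and ones: "\<And>T s D. J T \<Longrightarrow> t0 < s \<Longrightarrow> s \<le> t0 + L \<Longrightarrow> 1 \<le> births T D s"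
    and n: "large n" "1 \<le> L" "L \<le> n"
  shows "emeasure TS {T \<in> space TS. J T \<and> \<not> noisy t0 T C n \<and> (\<forall>k. L \<le> k \<and> k < n \<longrightarrow> noisy t0 T (other C) k)}
    \<le> ennreal (2 / (real n)\<^sup>2) * emeasure TS {T \<in> space TS. J T}" (is "emeasure TS ?F \<le> _")
proof -
  have [measurable]: "Measurable.pred TS J" by (rule births_uptoD(1)[OF J])
  let ?lo = "t0 + n div 2" and ?t = "t0 + n" and ?W = "bin_weight (slow n)"
  let ?A = "{T \<in> space TS. J T \<and> weight ?W T C ?lo ?t \<le> level n}"
  \<comment> \<open>\<open>S\<close> and \<open>l\<close> translate steps into ages, so that the
    noise required at step \<open>k\<close> is the one in \<open>noisy\<close> at age
    \<open>k - t0\<close>. From age \<open>n div 2\<close> on its bound is at least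
    \<open>?r\<close>, as \<open>depth\<close> is monotone.\<close>
  define S where "S k = slow (k - t0)" for k
  define l where "l k = t0 + (k - t0) div 2" for k
  let ?r = "level (n div 2) / 2"
  let ?B = "{T \<in> space TS. J T \<and> level n \<le> weight ?W T C ?lo ?t \<and>
      stuck_weight ?W T C ?lo ?t \<le> weight ?W T C ?lo ?t / 2 \<and>
      (\<forall>k. t0 + L \<le> k \<and> ?lo \<le> k \<and> k < ?t \<longrightarrow> ?r \<le> stuck_weight (bin_weight (S k)) T (other C) (l k) k)}"
  have slow: "slow n \<subseteq> {1..depth n}" "\<And>j. j \<in> slow n \<Longrightarrow> p j \<le> threshold"
    by (auto simp: slow_def)
  have n2: "2 \<le> n" using n by (simp add: large_def)
  have "emeasure TS ?A \<le> ennreal (exp (level n / threshold - \<beta> * real (card (slow n)) / (4 * threshold))) *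
      emeasure TS {T \<in> space TS. J T}"
  proof (rule small_weight_unlikely[OF J _ slow threshold_pos])
    show "2 * (\<Sum>i\<le>depth n. 1 / p i) \<le> real (n - n div 2)" using n by (simp add: large_def)
    show "1 \<le> births T C s" if "J T" "?lo < s" "s \<le> t0 + L" for T s
      using that by (intro ones) auto
  qed auto
  also have "\<dots> \<le> ennreal (1 / (real n)\<^sup>2) * emeasure TS {T \<in> space TS. J T}"
  proof (intro mult_right_mono ennreal_leI)
    have "\<beta> * (\<eta> * real (depth n)) \<le> \<beta> * real (card (slow n))"
      using n \<beta>_bounds by (intro mult_left_mono) (auto simp: large_def)
    then have "8 * level n / (4 * threshold) \<le> \<beta> * real (card (slow n)) / (4 * threshold)"
      using threshold_pos by (intro divide_right_mono) (auto simp: level_def)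
    then have "level n / threshold - \<beta> * real (card (slow n)) / (4 * threshold) \<le> - (level n / threshold)"
      by simp
    also have "\<dots> \<le> - (level n / (4 * threshold))"
      using n threshold_pos by (auto simp: large_def field_simps)
    finally have "exp (level n / threshold - \<beta> * real (card (slow n)) / (4 * threshold)) \<le>
        exp (- (level n / (4 * threshold)))" by simp
    also have "\<dots> \<le> 1 / (real n)\<^sup>2" using n by (simp add: large_def)
    finally show "exp (level n / threshold - \<beta> * real (card (slow n)) / (4 * threshold)) \<le> 1 / (real n)\<^sup>2" .
  qed simp
  finally have A: "emeasure TS ?A \<le> ennreal (1 / (real n)\<^sup>2) * emeasure TS {T \<in> space TS. J T}" .
  have "emeasure TS ?B \<le> ennreal (exp (- (level n / (4 * threshold)))) * emeasure TS {T \<in> space TS. J T}"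
  proof (rule unsticking_unlikely[OF J _ slow threshold_pos])
    show "1 \<le> births T D s" if "J T" "?lo < s" "s \<le> t0 + L" for T s D
      using that by (intro ones) auto
  qed (use n in \<open>auto simp: large_def\<close>)
  also have "\<dots> \<le> ennreal (1 / (real n)\<^sup>2) * emeasure TS {T \<in> space TS. J T}"
    using n by (intro mult_right_mono ennreal_leI) (auto simp: large_def)
  finally have B: "emeasure TS ?B \<le> ennreal (1 / (real n)\<^sup>2) * emeasure TS {T \<in> space TS. J T}" .
  have "?F \<subseteq> ?A \<union> ?B"
  proof
    fix T assume F: "T \<in> ?F"
    show "T \<in> ?A \<union> ?B"
    proof (cases "weight ?W T C ?lo ?t \<le> level n")
      case False
      have "?r \<le> stuck_weight (bin_weight (S k)) T (other C) (l k) k"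
        if k: "t0 + L \<le> k" "?lo \<le> k" "k < ?t" for k
      proof -
        have "L \<le> k - t0 \<and> k - t0 < n" using k by auto
        then have "noisy t0 T (other C) (k - t0)" using F by blast
        moreover have "depth (n div 2) \<le> depth (k - t0)"
          using k n2 by (intro depth_mono) auto
        then have "level (n div 2) \<le> level (k - t0)"
          using \<beta>_bounds \<eta> by (auto simp: level_def intro!: mult_left_mono)
        ultimately show ?thesis using k by (simp add: noisy_def S_def l_def)
      qed
      moreover have "stuck_weight ?W T C ?lo ?t \<le> weight ?W T C ?lo ?t / 2"
        using F False by (auto simp: noisy_def)
      ultimately show ?thesis using F False by auto
    qed (use F in auto)
  qed
  moreover have As: "?A \<in> sets TS" by measurable
  moreover have Bs: "?B \<in> sets TS" by measurable
  ultimately have "emeasure TS ?F \<le> emeasure TS (?A \<union> ?B)" by (intro emeasure_mono sets.Un)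
  also have "\<dots> \<le> emeasure TS ?A + emeasure TS ?B" by (intro emeasure_subadditive As Bs)
  also have "\<dots> \<le> ennreal (1 / (real n)\<^sup>2) * emeasure TS {T \<in> space TS. J T} +
      ennreal (1 / (real n)\<^sup>2) * emeasure TS {T \<in> space TS. J T}"
    by (intro add_mono A B)
  also have "\<dots> = ennreal (1 / (real n)\<^sup>2 + 1 / (real n)\<^sup>2) * emeasure TS {T \<in> space TS. J T}"
    by (subst ennreal_plus) (auto simp: distrib_right)
  finally show ?thesis by simp
qed

text \<open>At the least age from \<open>L\<close> on at which some stream fails, both were noisy
  before, so the previous bound applies to the failing one; two streams give the numerator
  4.\<close>

lemma failure_unlikely:
  assumes J: "births_upto (t0 + L) J"
    and ones: "\<And>T s D. J T \<Longrightarrow> t0 < s \<Longrightarrow> s \<le> t0 + L \<Longrightarrow> 1 \<le> births T D s"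
    and L: "\<And>n. L \<le> n \<Longrightarrow> large n" "1 \<le> L"
  shows "emeasure TS {T \<in> space TS. J T \<and> (\<exists>n\<ge>L. \<exists>C. \<not> noisy t0 T C n)}
    \<le> ennreal (\<Sum>i. 4 / (real (i + L))\<^sup>2) * emeasure TS {T \<in> space TS. J T}"
proof -
  have [measurable]: "Measurable.pred TS J" by (rule births_uptoD(1)[OF J])
  let ?F = "\<lambda>C n. {T \<in> space TS. J T \<and> \<not> noisy t0 T C n \<and> (\<forall>k. L \<le> k \<and> k < n \<longrightarrow> noisy t0 T (other C) k)}"
  let ?U = "\<lambda>i. ?F StreamA (i + L) \<union> ?F StreamB (i + L)"
  have "{T \<in> space TS. J T \<and> (\<exists>n\<ge>L. \<exists>C. \<not> noisy t0 T C n)} \<subseteq> (\<Union>i. ?U i)"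
  proof
    fix T assume T: "T \<in> {T \<in> space TS. J T \<and> (\<exists>n\<ge>L. \<exists>C. \<not> noisy t0 T C n)}"
    define n where "n = (LEAST n. L \<le> n \<and> (\<exists>C. \<not> noisy t0 T C n))"
    have n: "L \<le> n" "\<exists>C. \<not> noisy t0 T C n"
      using T LeastI_ex[of "\<lambda>n. L \<le> n \<and> (\<exists>C. \<not> noisy t0 T C n)"] unfolding n_def by blast+
    have "noisy t0 T C k" if "L \<le> k" "k < n" for C k
      using not_less_Least[of k "\<lambda>n. L \<le> n \<and> (\<exists>C. \<not> noisy t0 T C n)"] that unfolding n_def by blast
    with n T obtain C where C: "T \<in> ?F C n" by blast
    obtain i where i: "n = i + L" using n(1) by (metis le_add_diff_inverse2)
    have "?F C n \<subseteq> ?U i" unfolding i by (cases C) (simp_all only: Un_upper1 Un_upper2)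
    then show "T \<in> (\<Union>i. ?U i)" using C by blast
  qed
  then have "emeasure TS {T \<in> space TS. J T \<and> (\<exists>n\<ge>L. \<exists>C. \<not> noisy t0 T C n)} \<le> emeasure TS (\<Union>i. ?U i)"
    by (rule emeasure_mono) measurable
  also have "\<dots> \<le> (\<Sum>i. emeasure TS (?U i))"
    by (intro emeasure_subadditive_countably) (auto intro!: sets.Un)
  also have "\<dots> \<le> (\<Sum>i. ennreal (4 / (real (i + L))\<^sup>2) * emeasure TS {T \<in> space TS. J T})"
  proof (intro suminf_le summableI)
    fix i
    have F: "emeasure TS (?F C (i + L)) \<le> ennreal (2 / (real (i + L))\<^sup>2) * emeasure TS {T \<in> space TS. J T}" for C
      by (rule first_failure_unlikely[OF J ones]) (use L in auto)
    have "emeasure TS (?U i) \<le> emeasure TS (?F StreamA (i + L)) + emeasure TS (?F StreamB (i + L))"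
      by (intro emeasure_subadditive) measurable
    also have "\<dots> \<le> ennreal (2 / (real (i + L))\<^sup>2) * emeasure TS {T \<in> space TS. J T} +
       ennreal (2 / (real (i + L))\<^sup>2) * emeasure TS {T \<in> space TS. J T}"
      by (intro add_mono F)
    also have "\<dots> = ennreal (2 / (real (i + L))\<^sup>2 + 2 / (real (i + L))\<^sup>2) * emeasure TS {T \<in> space TS. J T}"
      by (subst ennreal_plus) (auto simp: distrib_right)
    finally show "emeasure TS (?U i) \<le> ennreal (4 / (real (i + L))\<^sup>2) * emeasure TS {T \<in> space TS. J T}" by simp
  qed
  also have "\<dots> = (\<Sum>i. ennreal (4 / (real (i + L))\<^sup>2)) * emeasure TS {T \<in> space TS. J T}"
    by (rule ennreal_suminf_multc)
  also have "(\<Sum>i. ennreal (4 / (real (i + L))\<^sup>2)) = ennreal (\<Sum>i. 4 / (real (i + L))\<^sup>2)"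
  proof (rule suminf_ennreal2)
    have "summable (\<lambda>n. 4 * (1 / (real n)\<^sup>2))"
      using inverse_power_summable[of 2, where 'a = real] by (intro summable_mult) (simp add: inverse_eq_divide)
    then show "summable (\<lambda>i. 4 / (real (i + L))\<^sup>2)"
      using summable_ignore_initial_segment[of "\<lambda>n. 4 * (1 / (real n)\<^sup>2)" L] by simp
  qed auto
  finally show ?thesis .
qed

end

section \<open>Attempts\<close>

context jammed
begin

text \<open>Windows are aligned to multiples of \<open>L\<close>, hence disjoint, which makes these
  events independent.\<close>

definition ignition :: "nat \<Rightarrow> nat \<Rightarrow> two_stream \<Rightarrow> bool" where
  "ignition L n T \<longleftrightarrow> (\<forall>s\<in>{n * L<..n * L + L}. \<forall>C. 1 \<le> births T C s)"

definition first_ignition :: "nat \<Rightarrow> nat \<Rightarrow> two_stream \<Rightarrow> bool" where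
  "first_ignition L n T \<longleftrightarrow> ignition L n T \<and> (\<forall>k<n. \<not> ignition L k T)"

lemma all_stream_label: "(\<forall>C. P C) \<longleftrightarrow> P StreamA \<and> P StreamB"
  by (metis stream_label.exhaust)

lemma measurable_births_pos [measurable]:
  assumes "a < s"
  shows "Measurable.pred TS (\<lambda>T. 1 \<le> births T C s)"
proof -
  have [measurable]: "(\<lambda>T. births T C s) \<in> measurable TS (count_space UNIV)"
    using assms by (intro measurable_births) auto
  show ?thesis by measurable
qed

lemma measurable_ignition [measurable]: "Measurable.pred TS (ignition L n)"
proof -
  let ?P = "\<lambda>s T. 1 \<le> births T StreamA s \<and> 1 \<le> births T StreamB s"
  have [measurable]: "Measurable.pred TS (?P s)" if "s \<in> {n * L<..n * L + L}" for s
    using that by (intro pred_intros_logic measurable_births_pos[of "n * L"]) simp_all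
  have "Measurable.pred TS (\<lambda>T. \<forall>s\<in>{n * L<..n * L + L}. ?P s T)"
    by measurable
  moreover have "ignition L n = (\<lambda>T. \<forall>s\<in>{n * L<..n * L + L}. ?P s T)"
    by (intro ext) (simp only: ignition_def all_stream_label)
  ultimately show ?thesis by (simp only:)
qed

lemma births_upto_first_ignition: "births_upto (n * L + L) (first_ignition L n)"
  unfolding births_upto_def
proof (intro conjI allI impI)
  show "Measurable.pred TS (first_ignition L n)"
    unfolding first_ignition_def by measurable
  fix T T' assume *: "\<forall>C s. s \<le> n * L + L \<longrightarrow> births T C s = births T' C s"
  have "ignition L k T = ignition L k T'" if "k \<le> n" for k
  proof -
    have k: "k * L \<le> n * L" using that by simp
    have "births T C s = births T' C s" if "s \<in> {k * L<..k * L + L}" for s C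
    proof -
      from that have "s \<le> k * L + L" by simp
      with k have "s \<le> n * L + L" by linarith
      then show ?thesis using * by blast
    qed
    then show ?thesis unfolding ignition_def by auto
  qed
  then show "first_ignition L n T = first_ignition L n T'"
    unfolding first_ignition_def by auto
qed

lemma nn_integral_all_births:
  assumes "finite F" "\<And>x. x \<in> F \<Longrightarrow> 1 \<le> snd x"
  shows "(\<integral>\<^sup>+T. (\<Prod>x\<in>F. indicator {True} (1 \<le> births T (fst x) (snd x))) \<partial>TS) = ennreal \<beta> ^ card F"
  using assms
proof (induction F rule: finite_induct)
  case empty
  then show ?case by (simp add: TS.emeasure_space_1)
next
  case (insert x F)
  let ?I = "\<lambda>x T. indicator {True} (1 \<le> births T (fst x) (snd x)) :: ennreal"
  let ?KB = "\<lambda>C. if C = fst x then {snd x} else {}" and ?KC = "\<lambda>_ :: stream_label. {}"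
  have [measurable]: "?I y \<in> borel_measurable TS" if "y \<in> insert x F" for y
  proof -
    have [measurable]: "(\<lambda>T. births T (fst y) (snd y)) \<in> measurable TS (count_space UNIV)"
      by (rule measurable_births[OF insert.prems[OF that]])
    show ?thesis by measurable
  qed
  have "(\<integral>\<^sup>+T. (\<Prod>x\<in>insert x F. ?I x T) \<partial>TS) = (\<integral>\<^sup>+T. (\<Prod>x\<in>F. ?I x T) * ?I x T \<partial>TS)"
    using insert by (simp add: mult.commute)
  also have "\<dots> = (\<integral>\<^sup>+T. (\<Prod>x\<in>F. ?I x T) \<partial>TS) * (\<integral>\<^sup>+T. ?I x T \<partial>TS)"
  proof (rule nn_integral_mult_mix[where KB = ?KB and KC = ?KC])
    fix T T'
    have "?I y (mix ?KB ?KC T T') = ?I y T" if "y \<in> F" for y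
      using that insert by (cases y; cases x) auto
    then show "(\<Prod>x\<in>F. ?I x (mix ?KB ?KC T T')) = (\<Prod>x\<in>F. ?I x T)" by simp
    show "?I x (mix ?KB ?KC T T') = ?I x T'" by simp
  qed measurable
  also have "(\<integral>\<^sup>+T. ?I x T \<partial>TS) = ennreal \<beta>"
    using nn_integral_births[of "snd x" "indicator {True}" "fst x"] insert.prems by simp
  finally show ?case using insert by (simp add: mult.commute)
qed

lemma nn_integral_no_ignition:
  "(\<integral>\<^sup>+T. indicator {T. \<not> ignition L n T} T \<partial>TS) = ennreal (1 - \<beta> ^ (2 * L))"
proof -
  let ?F = "{StreamA, StreamB} \<times> {n * L<..n * L + L}"
  have "(\<integral>\<^sup>+T. indicator {T. ignition L n T} T \<partial>TS) =
      (\<integral>\<^sup>+T. (\<Prod>x\<in>?F. indicator {True} (1 \<le> births T (fst x) (snd x))) \<partial>TS)"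
  proof (intro nn_integral_cong)
    fix T
    show "indicator {T. ignition L n T} T = (\<Prod>x\<in>?F. indicator {True} (1 \<le> births T (fst x) (snd x)) :: ennreal)"
    proof (cases "ignition L n T")
      case True
      have "(\<Prod>x\<in>?F. indicator {True} (1 \<le> births T (fst x) (snd x)) :: ennreal) = 1"
      proof (intro prod.neutral ballI)
        fix x assume "x \<in> ?F"
        then have "1 \<le> births T (fst x) (snd x)" using True by (auto simp only: ignition_def mem_Times_iff)
        then show "indicator {True} (1 \<le> births T (fst x) (snd x)) = (1 :: ennreal)" by simp
      qed
      then show ?thesis using True by simp
    next
      case False
      then obtain s C where "s \<in> {n * L<..n * L + L}" "\<not> 1 \<le> births T C s" by (auto simp: ignition_def)
      then have "\<exists>x\<in>?F. indicator {True} (1 \<le> births T (fst x) (snd x)) = (0 :: ennreal)"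
        by (intro bexI[of _ "(C, s)"]) (cases C; auto)+
      then have "(\<Prod>x\<in>?F. indicator {True} (1 \<le> births T (fst x) (snd x)) :: ennreal) = 0"
        by (intro prod_zero) auto
      then show ?thesis using False by simp
    qed
  qed
  also have "\<dots> = ennreal (\<beta> ^ (2 * L))"
    using \<beta>_bounds by (subst nn_integral_all_births) (auto simp: card_cartesian_product ennreal_power mult_2)
  finally have 1: "(\<integral>\<^sup>+T. indicator {T. ignition L n T} T \<partial>TS) = ennreal (\<beta> ^ (2 * L))" .
  have "1 = (\<integral>\<^sup>+T. indicator {T. ignition L n T} T + indicator {T. \<not> ignition L n T} T \<partial>TS)"
    by (subst nn_integral_cong[where v = "\<lambda>_. 1"]) (auto simp: indicator_def TS.emeasure_space_1)
  also have "\<dots> = ennreal (\<beta> ^ (2 * L)) + (\<integral>\<^sup>+T. indicator {T. \<not> ignition L n T} T \<partial>TS)"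
    unfolding 1[symmetric] by (rule nn_integral_add) measurable
  finally have 2: "ennreal (\<beta> ^ (2 * L)) + (\<integral>\<^sup>+T. indicator {T. \<not> ignition L n T} T \<partial>TS) = 1" ..
  have "(\<integral>\<^sup>+T. indicator {T. \<not> ignition L n T} T \<partial>TS) =
      ennreal (\<beta> ^ (2 * L)) + (\<integral>\<^sup>+T. indicator {T. \<not> ignition L n T} T \<partial>TS) - ennreal (\<beta> ^ (2 * L))"
    by simp
  then show ?thesis
    unfolding 2 using \<beta>_bounds by (simp add: ennreal_minus flip: ennreal_1)
qed

text \<open>The births in the window of index \<open>n\<close> are not read by earlier windows, so
  resampling them splits off one factor.\<close>

lemma emeasure_no_ignition:
  "emeasure TS {T \<in> space TS. \<forall>k<n. \<not> ignition L k T} = ennreal ((1 - \<beta> ^ (2 * L)) ^ n)"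
proof (induction n)
  case 0
  then show ?case by (simp add: TS.emeasure_space_1)
next
  case (Suc n)
  let ?G = "\<lambda>T. indicator {T. \<forall>k<n. \<not> ignition L k T} T :: ennreal"
  let ?H = "\<lambda>T. indicator {T. \<not> ignition L n T} T :: ennreal"
  let ?KB = "\<lambda>_ :: stream_label. {n * L<..n * L + L}" and ?KC = "\<lambda>_ :: stream_label. {}"
  have b: "0 \<le> 1 - \<beta> ^ (2 * L)" using \<beta>_bounds by (simp add: power_le_one)
  have "emeasure TS {T \<in> space TS. \<forall>k<Suc n. \<not> ignition L k T} =
      (\<integral>\<^sup>+T. indicator {T. \<forall>k<Suc n. \<not> ignition L k T} T \<partial>TS)"
    by (rule nn_integral_indicator_Collect[symmetric]) measurable
  also have "\<dots> = (\<integral>\<^sup>+T. ?G T * ?H T \<partial>TS)"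
    by (intro nn_integral_cong) (auto simp: indicator_def less_Suc_eq)
  also have "\<dots> = (\<integral>\<^sup>+T. ?G T \<partial>TS) * (\<integral>\<^sup>+T. ?H T \<partial>TS)"
  proof (rule nn_integral_mult_mix[where KB = ?KB and KC = ?KC])
    fix T T'
    have "ignition L k (mix ?KB ?KC T T') = ignition L k T" if "k < n" for k
    proof -
      have "k * L + L \<le> n * L" using that by (metis Suc_leI add.commute mult_Suc mult_le_mono1)
      then show ?thesis unfolding ignition_def by auto
    qed
    then show "?G (mix ?KB ?KC T T') = ?G T" by (simp add: indicator_def)
    show "?H (mix ?KB ?KC T T') = ?H T'" by (simp add: indicator_def ignition_def)
  qed measurable
  also have "(\<integral>\<^sup>+T. ?G T \<partial>TS) = ennreal ((1 - \<beta> ^ (2 * L)) ^ n)"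
    unfolding Suc.IH[symmetric] by (rule nn_integral_indicator_Collect) measurable
  finally show ?case
    using b by (simp add: nn_integral_no_ignition ennreal_mult[symmetric] mult.commute)
qed

lemma AE_ignition: "AE T in TS. \<exists>n. ignition L n T"
proof -
  let ?N = "{T \<in> space TS. \<forall>n. \<not> ignition L n T}"
  let ?x = "1 - \<beta> ^ (2 * L)"
  have x: "0 \<le> ?x" "?x < 1" using \<beta>_bounds by (simp_all add: power_le_one)
  have "(\<lambda>n. ennreal (?x ^ n)) \<longlonglongrightarrow> ennreal 0"
    using x by (intro tendsto_ennrealI LIMSEQ_power_zero) auto
  moreover have "emeasure TS ?N \<le> ennreal (?x ^ n)" for n
    unfolding emeasure_no_ignition[symmetric] by (intro emeasure_mono) (auto, measurable)
  ultimately have "emeasure TS ?N \<le> ennreal 0"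
    by (intro LIMSEQ_le_const) auto
  then have "emeasure TS ?N = 0" by simp
  then show ?thesis by (intro AE_I[of _ _ ?N]) auto
qed

end

context suitable_jammed
begin

text \<open>
  The first ignition is an event about the births up to its end, so that conditioning on it does not
  affect the later randomness.
\<close>
lemma recovery_unlikely:
  assumes "0 < \<epsilon>"
  shows "\<exists>N\<in>sets TS. emeasure TS N \<le> ennreal \<epsilon> \<and> (AE T in TS. infinite (recovery_times T) \<longrightarrow> T \<in> N)"
proof -
  have "summable (\<lambda>n. 4 * (1 / (real n)\<^sup>2))"
    using inverse_power_summable[of 2, where 'a = real] by (intro summable_mult) (simp add: inverse_eq_divide)
  \<comment> \<open>A window of length \<open>L\<close> leaves only failures at ages from
    \<open>L\<close> on, so its length is chosen to make the tail of the series smaller than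
    \<open>\<epsilon>\<close>.\<close>
  then obtain L1 where L1: "\<And>n. L1 \<le> n \<Longrightarrow> norm (\<Sum>i. 4 * (1 / (real (i + n))\<^sup>2)) < \<epsilon>"
    using suminf_exist_split[OF assms] by blast
  obtain L2 where L2: "\<And>n. L2 \<le> n \<Longrightarrow> large n"
    using eventually_large by (auto simp: eventually_at_top_linorder)
  define L where "L = max 1 (max L1 L2)"
  have L: "\<And>n. L \<le> n \<Longrightarrow> large n" "1 \<le> L"
    using L2 by (auto simp: L_def)
  have "L1 \<le> L" by (simp add: L_def)
  from L1[OF this] have \<epsilon>: "(\<Sum>i. 4 / (real (i + L))\<^sup>2) \<le> \<epsilon>" by simp
  let ?J = "first_ignition L"
  let ?B = "\<lambda>n. {T \<in> space TS. ?J n T \<and> (\<exists>k\<ge>L. \<exists>C. \<not> noisy (n * L) T C k)}"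
  have J [measurable]: "Measurable.pred TS (?J n)" for n
    by (rule births_uptoD(1)[OF births_upto_first_ignition])
  have ex: "(\<exists>C. \<not> noisy a T C k) \<longleftrightarrow> \<not> noisy a T StreamA k \<or> \<not> noisy a T StreamB k" for a T k
    by (metis stream_label.exhaust)
  have B: "?B n \<in> sets TS" for n unfolding ex by measurable
  have le: "emeasure TS (?B n) \<le> ennreal \<epsilon> * emeasure TS {T \<in> space TS. ?J n T}" for n
  proof -
    have "emeasure TS (?B n) \<le> ennreal (\<Sum>i. 4 / (real (i + L))\<^sup>2) * emeasure TS {T \<in> space TS. ?J n T}"
      by (rule failure_unlikely[OF births_upto_first_ignition _ L])
        (auto simp: first_ignition_def ignition_def)
    also have "\<dots> \<le> ennreal \<epsilon> * emeasure TS {T \<in> space TS. ?J n T}"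
      by (intro mult_right_mono ennreal_leI \<epsilon>) simp
    finally show ?thesis .
  qed
  \<comment> \<open>The first ignitions have total probability at most 1, so the failure bound, a
    fraction \<open>\<epsilon>\<close> of each, survives the union over all windows.\<close>
  have disj: "disjoint_family (\<lambda>n. {T \<in> space TS. ?J n T})"
    unfolding disjoint_family_on_def first_ignition_def
    by (auto) (metis nat_neq_iff)
  have "emeasure TS (\<Union>n. ?B n) \<le> (\<Sum>n. emeasure TS (?B n))"
    by (intro emeasure_subadditive_countably image_subsetI B)
  also have "\<dots> \<le> (\<Sum>n. ennreal \<epsilon> * emeasure TS {T \<in> space TS. ?J n T})"
    by (intro suminf_le le summableI)
  also have "\<dots> = ennreal \<epsilon> * (\<Sum>n. emeasure TS {T \<in> space TS. ?J n T})"
    by (rule ennreal_suminf_cmult)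
  also have "(\<Sum>n. emeasure TS {T \<in> space TS. ?J n T}) = emeasure TS (\<Union>n. {T \<in> space TS. ?J n T})"
    using disj by (intro suminf_emeasure) auto
  also have "ennreal \<epsilon> * emeasure TS (\<Union>n. {T \<in> space TS. ?J n T}) \<le> ennreal \<epsilon> * 1"
    by (intro mult_left_mono TS.emeasure_le_1) simp
  finally have small: "emeasure TS (\<Union>n. ?B n) \<le> ennreal \<epsilon>" by simp
  have "AE T in TS. infinite (recovery_times T) \<longrightarrow> T \<in> (\<Union>n. ?B n)"
    using AE_ignition[of L] AE_space
  proof eventually_elim
    case (elim T)
    define n where "n = (LEAST n. ignition L n T)"
    have n: "?J n T"
      using LeastI_ex[OF elim(1)] not_less_Least unfolding first_ignition_def n_def by blast
    show ?case
    proof (rule impI, rule ccontr)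
      assume inf: "infinite (recovery_times T)" and "T \<notin> (\<Union>n. ?B n)"
      then have "T \<notin> ?B n" by blast
      then have "\<not> (\<exists>k\<ge>L. \<exists>C. \<not> noisy (n * L) T C k)" using n elim(2) by simp
      then have noisy: "noisy (n * L) T StreamA k" if "L \<le> k" for k
        using that by blast
      have "recovery_times T \<subseteq> {..<n * L + L}"
      proof
        fix t assume t: "t \<in> recovery_times T"
        show "t \<in> {..<n * L + L}"
        proof (rule ccontr)
          assume "t \<notin> {..<n * L + L}"
          then obtain k where k: "t = n * L + k" "L \<le> k"
            by (intro that[of "t - n * L"]) auto
          have "0 < level k" using L(1)[OF k(2)] by (simp add: large_def)
          then have "0 < stuck_weight (bin_weight (slow k)) T StreamA (n * L + k div 2) t"
            using noisy[OF k(2)] by (simp add: noisy_def k(1))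
          then show False using stuck_nonempty t by (auto simp: recovery_times_def)
        qed
      qed
      then show False using inf finite_subset by blast
    qed
  qed
  moreover have "(\<Union>n. ?B n) \<in> sets TS" by (intro sets.countable_UN image_subsetI B)
  ultimately show ?thesis using small by (intro bexI[of _ "\<Union>n. ?B n"] conjI)
qed

text \<open>The exceptional event is covered by measurable sets of measure at most
  \<open>1 / Suc k\<close>, whose intersection is a null set.\<close>

lemma AE_finite_recovery_times: "AE T in TS. finite (recovery_times T)"
proof -
  have "\<forall>k :: nat. \<exists>N. N \<in> sets TS \<and> emeasure TS N \<le> ennreal (1 / Suc k) \<and>
      (AE T in TS. infinite (recovery_times T) \<longrightarrow> T \<in> N)" (is "\<forall>k. \<exists>N. ?P k N")
  proof
    fix k :: nat
    show "\<exists>N. ?P k N" using recovery_unlikely[of "1 / Suc k"] by auto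
  qed
  then obtain N where N': "\<forall>k. ?P k (N k)" by (rule choice[THEN exE])
  then have N: "N k \<in> sets TS" "emeasure TS (N k) \<le> ennreal (1 / Suc k)"
      "AE T in TS. infinite (recovery_times T) \<longrightarrow> T \<in> N k" for k
    by blast+
  have "emeasure TS (\<Inter>k. N k) \<le> ennreal (1 / Suc k)" for k
    using N(1,2)[of k] emeasure_mono[of "\<Inter>k. N k" "N k" TS] by (meson INT_lower UNIV_I order_trans)
  moreover have "(\<lambda>k. ennreal (1 / Suc k)) \<longlonglongrightarrow> ennreal 0"
    by (intro tendsto_ennrealI LIMSEQ_Suc[OF lim_1_over_n])
  ultimately have "emeasure TS (\<Inter>k. N k) \<le> ennreal 0"
    by (intro LIMSEQ_le_const) auto
  then have "(\<Inter>k. N k) \<in> null_sets TS"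
    using N(1) by (auto simp: null_sets_def)
  then have "AE T in TS. T \<notin> (\<Inter>k. N k)" by (rule AE_not_in)
  moreover have "AE T in TS. \<forall>k. infinite (recovery_times T) \<longrightarrow> T \<in> N k"
    by (subst AE_all_countable) (intro allI N(3))
  ultimately show ?thesis by eventually_elim auto
qed

end

theorem theorem3p5:
  fixes lam \<eta> \<nu> :: real and p :: "nat \<Rightarrow> real"
    and M :: "'a measure" and T :: "'a \<Rightarrow> two_stream"
  assumes "0 < lam" "lam < 1" "0 < \<eta>" "\<eta> < 1" "0 < \<nu>" "\<nu> < 1"
    and "suitable lam \<eta> \<nu> p"
    and "two_stream_process M lam p T"
  shows "AE \<omega> in M. finite (recovery_times (T \<omega>))"
proof -
  interpret suitable_jammed lam p \<eta> \<nu>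
    using assms by unfold_locales (auto simp: suitable_def)
  have "has_law T M TS"
    using assms(8) by (simp add: two_stream_process_def has_law_def)
  then show ?thesis by (rule has_law_AE[OF _ AE_finite_recovery_times])
qed

end
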